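(* Consider the decentralized system with $N\in\mathbb N$ nested subsystems, Problem 1 and Problem 2 described in the context. In Problem 2 (minimizing $\hat{\mathcal J}(\hat{\boldsymbol g})$ over all partial control strategies), without loss of optimality one can restrict attention to partial strategies $\hat{\boldsymbol g}^*$ of the form $$\hat U_t^n=\hat g_t^{*n}\big(\Pi_t^{n},\Pi_t^{n+1},\dots,\Pi_t^{N}\big),\qquad t=0,\dots,T,\ n\in\mathcal N,$$ i.e. the minimum of $\hat{\mathcal J}$ over $\hat{\mathcal G}$ is attained by a partial strategy of this form. Furthermore, in Problem 1 (minimizing $\mathcal J(\boldsymbol g)$ over all $\boldsymbol g\in\mathcal G$), there exists an optimal control strategy $\boldsymbol g^{*}=(\boldsymbol g^{*k,n}:k\in\mathcal K^n,n\in\mathcal N)$ with the structural form $$U_t^{k,n}=g_t^{*k,n}\big(Y_t^{k,n},L_t^{k,n},\Pi_t^{n},\dots,\Pi_t^{N}\big),\qquad t=0,\dots,T,\ k\in\mathcal K^n,\ n\in\mathcal N.$$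
   Context: **System.** There are subsystems $\mathcal N=\{1,\dots,N\}$; subsystem $n$ has agents $\mathcal K^n=\{1,\dots,K^n\}$. Time runs over $t=0,\dots,T$. All variables are uncertain variables (variables with known finite feasible sets, no distributions). The state is $X_t\in\mathcal X_t$, the action of agent $k\in\mathcal K^n$ is $U_t^{k,n}\in\mathcal U_t^{k,n}$, $U_t^n=(U_t^{k,n}:k\in\mathcal K^n)$, $U_t^{1:N}=(U_t^1,\dots,U_t^N)$. Dynamics: $X_{t+1}=f_t(X_t,U_t^{1:N},W_t)$ for $t=0,\dots,T-1$, with disturbance $W_t\in\mathcal W_t$. Observations: $Y_t^{k,n}=h_t^{k,n}(X_t,V_t^{k,n})\in\mathcal Y_t^{k,n}$ with noise $V_t^{k,n}\in\mathcal V_t^{k,n}$; $V_t^n=(V_t^{k,n}:k\in\mathcal K^n)\in\mathcal V_t^n=\prod_{k}\mathcal V_t^{k,n}$. All sets are finite. The primitive variables are $X_0$, all $W_t$, all $V_t^{k,n}$; they are mutually independent (their joint feasible set is the Cartesian product of the individual feasible sets). **Information structure.** The memory of agent $k\in\mathcal K^n$ at time $t$ is a set of (labelled) variables $M_t^{k,n}\subseteq\{Y_{0:t-1}^{i,m},U_{0:t-1}^{i,m}: i\in\mathcal K^m,\ m\ge n\}$ with perfect recall $M_t^{k,n}\subseteq M_{t+1}^{k,n}$. Common information of subsystem $n$: $C_t^n=\bigcap_{k\in\mathcal K^n}M_t^{k,n}$, assumed nested ($C_t^m\subseteq C_t^n$ for $m>n$) and with perfect recall ($C_t^n\subseteq C_{t+1}^n$).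 Private information: $L_t^{k,n}=M_t^{k,n}\setminus C_t^n$, assumed to satisfy $L_t^{k,m}\cap C_t^n=\emptyset$ for all $m>n$, $k\in\mathcal K^m$. New information: $Z_t^n=C_t^n\setminus C_{t-1}^n$ with $C_{-1}^n=\emptyset$. The sets of possible realizations of $M_t^{k,n},C_t^n,L_t^{k,n},Z_t^n$ are $\mathcal M_t^{k,n},\mathcal C_t^n,\mathcal L_t^{k,n},\mathcal Z_t^n$ (finite). **Problem 1.** A control strategy $\boldsymbol g\in\mathcal G$ is a collection of arbitrary control laws $g_t^{k,n}:\mathcal Y_t^{k,n}\times\mathcal M_t^{k,n}\to\mathcal U_t^{k,n}$, with $U_t^{k,n}=g_t^{k,n}(Y_t^{k,n},M_t^{k,n})=g_t^{k,n}(Y_t^{k,n},L_t^{k,n},C_t^n)$. Given a terminal cost $d_T:\mathcal X_T\to\mathbb R_{\ge0}$, $\mathcal J(\boldsymbol g)=\max_{X_0,W_{0:T},V_{0:T}^{1:N}}d_T(X_T)$. Problem 1 is $\min_{\boldsymbol g\in\mathcal G}\mathcal J(\boldsymbol g)$. **Problem 2.** A partial action for agent $k\in\mathcal K^n$ at time $t$ is a mapping $\hat U_t^{k,n}:\mathcal Y_t^{k,n}\times\mathcal L_t^{k,n}\to\mathcal U_t^{k,n}$; $\hat{\mathcal U}_t^{k,n}$ is the finite set of these. A partial control law is a map $\hat g_t^{k,n}:\mathcal C_t^n\to\hat{\mathcal U}_t^{k,n}$, $\hat U_t^{k,n}=\hat g_t^{k,n}(C_t^n)$; write $\hat U_t^n=(\hat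 U_t^{k,n})_k=\hat g_t^n(C_t^n)$, $\hat{\mathcal U}_t^n=\prod_k\hat{\mathcal U}_t^{k,n}$, and $\hat{\boldsymbol g}=(\hat g_{0:T}^1,\dots,\hat g_{0:T}^N)\in\hat{\mathcal G}$. Actions are then $U_t^{k,n}=\hat U_t^{k,n}(Y_t^{k,n},L_t^{k,n})$. Let $L_t^n=\{Y_t^{k,n},L_t^{k,n}:k\in\mathcal K^n\}$ and $\hat X_t=\{X_t,L_t^1,\dots,L_t^N\}\in\hat{\mathcal X}_t$. There are functions (determined by the model) with $\hat X_{t+1}=\hat f_t(\hat X_t,\hat U_t^{1:N},W_t,V_{t+1}^{1:N})$, $Z_{t+1}^n=\hat h_t^n(\hat X_t,\hat U_t^{1:N})$, $\hat d_T(\hat X_T)=d_T(X_T)$. Problem 2 is $\min_{\hat{\boldsymbol g}\in\hat{\mathcal G}}\hat{\mathcal J}(\hat{\boldsymbol g})$ with $\hat{\mathcal J}(\hat{\boldsymbol g})=\max_{X_0,W_{0:T},V_{0:T}^{1:N}}\hat d_T(\hat X_T)$. **Information states.** Defined recursively for $n=1,\dots,N$. The information state $\Pi_t^n$ takes values in a finite collection $\mathcal P_t^n$ of subsets of $\hat{\mathcal X}_t\times\mathcal P_t^1\times\dots\times\mathcal P_t^{n-1}$. For $m<n$, a prescription by subsystem $n$ for subsystem $m$ is a mapping $\gamma_t^{[n,m]}:\mathcal P_t^m\times\dots\times\mathcal P_t^{n-1}\to\hat{\mathcal U}_t^m$; a complete action of subsystem $n$ is $\theta_t^n=(\gamma_t^{[n,1]},\dots,\gamma_t^{[n,n-1]},\hat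 u_t^n)$. Given realizations $c_t^n$ of the common information (with new-information components $z_{\ell}^n$), $\theta_{0:t-1}^n$ of the complete actions, and $\hat u_{0:t-1}^{n+1:N}$ of the partial actions of subsystems $n+1,\dots,N$, the realization $P_t^n$ of $\Pi_t^n$ is the set of all $(\hat x_t,P_t^1,\dots,P_t^{n-1})$ for which there exist values $x_0\in\mathcal X_0$, $w_{0:t-1}$, $v_{0:t}^{1:N}$ of the primitive variables that generate them along a trajectory such that, for $\ell=0,\dots,t-1$: $\hat u_\ell^m=\gamma_\ell^{[n,m]}(P_\ell^m,\dots,P_\ell^{n-1})$ for $m<n$; $\hat x_{\ell+1}=\hat f_\ell(\hat x_\ell,\hat u_\ell^{1:N},w_\ell,v_{\ell+1}^{1:N})$; $z_{\ell+1}^m=\hat h_\ell^m(\hat x_\ell,\hat u_\ell^{1:N})$ for $m<n$; the given observations satisfy $z_{\ell+1}^n=\hat h_\ell^n(\hat x_\ell,\hat u_\ell^{1:N})$; and for $m<n$, $P_{\ell}^m$ is the realization of $\Pi_{\ell}^m$ corresponding to subsystem $m$'s data along this trajectory, namely the observations $z_{1:\ell}^m$, the partial actions $\hat u_{0:\ell-1}^{m:N}$, and the prescriptions $\gamma_j^{[m,i]}(\cdot)=\gamma_j^{[n,i]}(\cdot,P_j^m,\dots,P_j^{n-1})$, $i<m$, $j<\ell$. (For $n=1$ there are no prescriptions and $P_t^1\subseteq\hat{\mathcal X}_t$ is the set of states $\hat x_t$ compatible with $c_t^1$ and $\hat u_{0:t-1}^{1:N}$.) When the partial strategy has the form $\hat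 U_t^n=\hat g_t^n(\Pi_t^n,\dots,\Pi_t^N)$ for all $n$, the prescriptions in this definition are $\gamma_t^{[n,m]}(\cdot)=\hat g_t^m(\cdot,\Pi_t^n,\dots,\Pi_t^N)$. Then $\Pi_t^n,\dots,\Pi_t^N$ are functions of $C_t^n$, so such a strategy is an admissible partial strategy. In the second part of the claim, the $\Pi_t^n$ are those associated in the same way with the partial actions $\hat U_t^{k,n}=g_t^{*k,n}(\cdot,\cdot,\Pi_t^n,\dots,\Pi_t^N)$. *)

theory Defs
  imports Complex_Main "HOL-Library.FuncSet" "HOL-Library.FSet"
begin

section \<open>The decentralized system\<close>

text \<open>Agents are addressed by a pair \<open>n k\<close> (agent \<open>k\<close> of subsystem \<open>n\<close>) and indexed families
  carry the time first, so that \<open>F t n k\<close> stands for $F_t^{k,n}$. Variables of the same kind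
  share one type; their individual feasible sets are carrier sets in that type.\<close>

datatype label = Obs nat nat nat | Act nat nat nat

text \<open>A realization of a set of labelled variables is a function on labels that is
  extensional on that set.\<close>

type_synonym ('y, 'u) realization = "label \<Rightarrow> 'y + 'u"

record ('x, 'u, 'y, 'w, 'v) system =
  horizon :: nat
  subsystems :: nat
  agents :: "nat \<Rightarrow> nat"
  states :: "nat \<Rightarrow> 'x set"
  actions :: "nat \<Rightarrow> nat \<Rightarrow> nat \<Rightarrow> 'u set"
  observations :: "nat \<Rightarrow> nat \<Rightarrow> nat \<Rightarrow> 'y set"
  disturbances :: "nat \<Rightarrow> 'w set"
  noises :: "nat \<Rightarrow> nat \<Rightarrow> nat \<Rightarrow> 'v set"
  dynamics :: "nat \<Rightarrow> 'x \<Rightarrow> (nat \<Rightarrow> nat \<Rightarrow> 'u) \<Rightarrow> 'w \<Rightarrow> 'x"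
  sensor :: "nat \<Rightarrow> nat \<Rightarrow> nat \<Rightarrow> 'x \<Rightarrow> 'v \<Rightarrow> 'y"
  memory :: "nat \<Rightarrow> nat \<Rightarrow> nat \<Rightarrow> label set"
  terminal_cost :: "'x \<Rightarrow> real"

abbreviation Subs :: "('x, 'u, 'y, 'w, 'v) system \<Rightarrow> nat set" where
  "Subs S \<equiv> {1..subsystems S}"

abbreviation Ags :: "('x, 'u, 'y, 'w, 'v) system \<Rightarrow> nat \<Rightarrow> nat set" where
  "Ags S n \<equiv> {1..agents S n}"

definition common_info :: "('x, 'u, 'y, 'w, 'v) system \<Rightarrow> nat \<Rightarrow> nat \<Rightarrow> label set" where
  "common_info S t n = (\<Inter>k\<in>Ags S n. memory S t n k)"

definition private_info :: "('x, 'u, 'y, 'w, 'v) system \<Rightarrow> nat \<Rightarrow> nat \<Rightarrow> nat \<Rightarrow> label set" where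
  "private_info S t n k = memory S t n k - common_info S t n"

definition new_info :: "('x, 'u, 'y, 'w, 'v) system \<Rightarrow> nat \<Rightarrow> nat \<Rightarrow> label set" where
  "new_info S t n = common_info S t n - (if t = 0 then {} else common_info S (t - 1) n)"

fun label_values :: "('x, 'u, 'y, 'w, 'v) system \<Rightarrow> label \<Rightarrow> ('y + 'u) set" where
  "label_values S (Obs t n k) = Inl ` observations S t n k"
| "label_values S (Act t n k) = Inr ` actions S t n k"

definition realizations ::
  "('x, 'u, 'y, 'w, 'v) system \<Rightarrow> label set \<Rightarrow> ('y, 'u) realization set" where
  "realizations S A = (\<Pi>\<^sub>E a\<in>A. label_values S a)"

locale nested_system =
  fixes S :: "('x, 'u, 'y, 'w, 'v) system"
  assumes subsystems_pos: "1 \<le> subsystems S"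
    and agents_pos: "n \<in> Subs S \<Longrightarrow> 1 \<le> agents S n"
    and states_finite: "t \<le> horizon S \<Longrightarrow> finite (states S t) \<and> states S t \<noteq> {}"
    and disturbances_finite:
      "t \<le> horizon S \<Longrightarrow> finite (disturbances S t) \<and> disturbances S t \<noteq> {}"
    and actions_finite:
      "\<lbrakk>t \<le> horizon S; n \<in> Subs S; k \<in> Ags S n\<rbrakk>
        \<Longrightarrow> finite (actions S t n k) \<and> actions S t n k \<noteq> {}"
    and observations_finite:
      "\<lbrakk>t \<le> horizon S; n \<in> Subs S; k \<in> Ags S n\<rbrakk>
        \<Longrightarrow> finite (observations S t n k) \<and> observations S t n k \<noteq> {}"
    and noises_finite:
      "\<lbrakk>t \<le> horizon S; n \<in> Subs S; k \<in> Ags S n\<rbrakk>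
        \<Longrightarrow> finite (noises S t n k) \<and> noises S t n k \<noteq> {}"
    and dynamics_closed:
      "\<lbrakk>t < horizon S; x \<in> states S t; u \<in> (\<Pi>\<^sub>E n\<in>Subs S. \<Pi>\<^sub>E k\<in>Ags S n. actions S t n k);
        w \<in> disturbances S t\<rbrakk> \<Longrightarrow> dynamics S t x u w \<in> states S (Suc t)"
    and sensor_closed:
      "\<lbrakk>t \<le> horizon S; n \<in> Subs S; k \<in> Ags S n; x \<in> states S t; v \<in> noises S t n k\<rbrakk>
        \<Longrightarrow> sensor S t n k x v \<in> observations S t n k"
    and cost_nonneg: "x \<in> states S (horizon S) \<Longrightarrow> 0 \<le> terminal_cost S x"
    and memory_nested:
      "\<lbrakk>t \<le> horizon S; n \<in> Subs S; k \<in> Ags S n\<rbrakk>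
        \<Longrightarrow> memory S t n k \<subseteq>
              {Obs s m i | s m i. s < t \<and> m \<in> Subs S \<and> n \<le> m \<and> i \<in> Ags S m} \<union>
              {Act s m i | s m i. s < t \<and> m \<in> Subs S \<and> n \<le> m \<and> i \<in> Ags S m}"
    and memory_recall:
      "\<lbrakk>t < horizon S; n \<in> Subs S; k \<in> Ags S n\<rbrakk> \<Longrightarrow> memory S t n k \<subseteq> memory S (Suc t) n k"
    and common_nested:
      "\<lbrakk>t \<le> horizon S; n \<in> Subs S; m \<in> Subs S; n < m\<rbrakk> \<Longrightarrow> common_info S t m \<subseteq> common_info S t n"
    and common_recall:
      "\<lbrakk>t < horizon S; n \<in> Subs S\<rbrakk> \<Longrightarrow> common_info S t n \<subseteq> common_info S (Suc t) n"
    and private_disjoint: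
      "\<lbrakk>t \<le> horizon S; n \<in> Subs S; m \<in> Subs S; n < m; k \<in> Ags S m\<rbrakk>
        \<Longrightarrow> private_info S t m k \<inter> common_info S t n = {}"

section \<open>Primitive variables and trajectories\<close>

record ('x, 'w, 'v) primitives =
  init_state :: 'x
  disturbance :: "nat \<Rightarrow> 'w"
  noise :: "nat \<Rightarrow> nat \<Rightarrow> nat \<Rightarrow> 'v"

definition feasible :: "('x, 'u, 'y, 'w, 'v) system \<Rightarrow> ('x, 'w, 'v) primitives set" where
  "feasible S = {\<omega>. init_state \<omega> \<in> states S 0
     \<and> disturbance \<omega> \<in> (\<Pi>\<^sub>E t\<in>{..horizon S}. disturbances S t)
     \<and> noise \<omega> \<in> (\<Pi>\<^sub>E t\<in>{..horizon S}. \<Pi>\<^sub>E n\<in>Subs S. \<Pi>\<^sub>E k\<in>Ags S n. noises S t n k)}"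

type_synonym ('y, 'u) control = "nat \<Rightarrow> nat \<Rightarrow> nat \<Rightarrow> 'y \<Rightarrow> ('y, 'u) realization \<Rightarrow> 'u"

definition controls :: "('x, 'u, 'y, 'w, 'v) system \<Rightarrow> ('y, 'u) control set" where
  "controls S = {g. \<forall>t\<le>horizon S. \<forall>n\<in>Subs S. \<forall>k\<in>Ags S n. \<forall>y\<in>observations S t n k.
     \<forall>m\<in>realizations S (memory S t n k). g t n k y m \<in> actions S t n k}"

definition extend_history ::
  "nat \<Rightarrow> (nat \<Rightarrow> nat \<Rightarrow> 'y) \<Rightarrow> (nat \<Rightarrow> nat \<Rightarrow> 'u) \<Rightarrow> ('y, 'u) realization \<Rightarrow> ('y, 'u) realization"
  where
  "extend_history t y u H = (\<lambda>a. case a of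
       Obs s n k \<Rightarrow> if s = t then Inl (y n k) else H a
     | Act s n k \<Rightarrow> if s = t then Inr (u n k) else H a)"

text \<open>The state at time \<open>t\<close> together with the values of all observations and actions before \<open>t\<close>.\<close>

primrec run :: "('x, 'u, 'y, 'w, 'v) system \<Rightarrow> ('y, 'u) control \<Rightarrow> ('x, 'w, 'v) primitives
    \<Rightarrow> nat \<Rightarrow> 'x \<times> ('y, 'u) realization" where
  "run S g \<omega> 0 = (init_state \<omega>, \<lambda>_. undefined)"
| "run S g \<omega> (Suc t) =
    (case run S g \<omega> t of (x, H) \<Rightarrow>
      let y = (\<lambda>n k. sensor S t n k x (noise \<omega> t n k));
          u = (\<lambda>n k. g t n k (y n k) (restrict H (memory S t n k)))
      in (dynamics S t x (\<lambda>n\<in>Subs S. \<lambda>k\<in>Ags S n. u n k) (disturbance \<omega> t), extend_history t y u H))"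

definition J :: "('x, 'u, 'y, 'w, 'v) system \<Rightarrow> ('y, 'u) control \<Rightarrow> real" where
  "J S g = Max ((\<lambda>\<omega>. terminal_cost S (fst (run S g \<omega> (horizon S)))) ` feasible S)"

section \<open>Partial strategies\<close>

text \<open>A partial action of a subsystem maps an agent \<open>k\<close> and a pair of its current observation
  and its private information to an action.\<close>

type_synonym ('y, 'u) partial_action = "nat \<Rightarrow> 'y \<times> ('y, 'u) realization \<Rightarrow> 'u"

type_synonym ('y, 'u) partial_strategy =
  "nat \<Rightarrow> nat \<Rightarrow> ('y, 'u) realization \<Rightarrow> ('y, 'u) partial_action"

definition partial_actions ::
  "('x, 'u, 'y, 'w, 'v) system \<Rightarrow> nat \<Rightarrow> nat \<Rightarrow> ('y, 'u) partial_action set" where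
  "partial_actions S t n =
    (\<Pi>\<^sub>E k\<in>Ags S n. \<Pi>\<^sub>E _\<in>observations S t n k \<times> realizations S (private_info S t n k). actions S t n k)"

definition partial_strategies ::
  "('x, 'u, 'y, 'w, 'v) system \<Rightarrow> ('y, 'u) partial_strategy set" where
  "partial_strategies S = {gh. \<forall>t\<le>horizon S. \<forall>n\<in>Subs S. \<forall>c\<in>realizations S (common_info S t n).
     gh t n c \<in> partial_actions S t n}"

definition induced_control ::
  "('x, 'u, 'y, 'w, 'v) system \<Rightarrow> ('y, 'u) partial_strategy \<Rightarrow> ('y, 'u) control" where
  "induced_control S gh t n k y m =
    gh t n (restrict m (common_info S t n)) k (y, restrict m (private_info S t n k))"

type_synonym ('x, 'y, 'u) xhat = "'x \<times> (nat \<Rightarrow> nat \<Rightarrow> 'y \<times> ('y, 'u) realization)"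

definition augment :: "('x, 'u, 'y, 'w, 'v) system \<Rightarrow> ('x, 'w, 'v) primitives \<Rightarrow> nat
    \<Rightarrow> 'x \<times> ('y, 'u) realization \<Rightarrow> ('x, 'y, 'u) xhat" where
  "augment S \<omega> t = (\<lambda>(x, H). (x, \<lambda>n\<in>Subs S. \<lambda>k\<in>Ags S n.
     (sensor S t n k x (noise \<omega> t n k), restrict H (private_info S t n k))))"

definition xhat_run :: "('x, 'u, 'y, 'w, 'v) system \<Rightarrow> ('y, 'u) partial_strategy
    \<Rightarrow> ('x, 'w, 'v) primitives \<Rightarrow> nat \<Rightarrow> ('x, 'y, 'u) xhat" where
  "xhat_run S gh \<omega> t = augment S \<omega> t (run S (induced_control S gh) \<omega> t)"

definition uhat_run :: "('x, 'u, 'y, 'w, 'v) system \<Rightarrow> ('y, 'u) partial_strategy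
    \<Rightarrow> ('x, 'w, 'v) primitives \<Rightarrow> nat \<Rightarrow> nat \<Rightarrow> ('y, 'u) partial_action" where
  "uhat_run S gh \<omega> t = (\<lambda>n\<in>Subs S.
     gh t n (restrict (snd (run S (induced_control S gh) \<omega> t)) (common_info S t n)))"

definition z_run :: "('x, 'u, 'y, 'w, 'v) system \<Rightarrow> ('y, 'u) partial_strategy
    \<Rightarrow> ('x, 'w, 'v) primitives \<Rightarrow> nat \<Rightarrow> nat \<Rightarrow> ('y, 'u) realization" where
  "z_run S gh \<omega> t n = restrict (snd (run S (induced_control S gh) \<omega> t)) (new_info S t n)"

definition terminal_cost_hat :: "('x, 'u, 'y, 'w, 'v) system \<Rightarrow> ('x, 'y, 'u) xhat \<Rightarrow> real" where
  "terminal_cost_hat S xh = terminal_cost S (fst xh)"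

definition Jhat :: "('x, 'u, 'y, 'w, 'v) system \<Rightarrow> ('y, 'u) partial_strategy \<Rightarrow> real" where
  "Jhat S gh = Max ((\<lambda>\<omega>. terminal_cost_hat S (xhat_run S gh \<omega> (horizon S))) ` feasible S)"

type_synonym ('x, 'u, 'y, 'w, 'v) fhat =
  "nat \<Rightarrow> ('x, 'y, 'u) xhat \<Rightarrow> (nat \<Rightarrow> ('y, 'u) partial_action) \<Rightarrow> 'w \<Rightarrow> (nat \<Rightarrow> nat \<Rightarrow> 'v)
    \<Rightarrow> ('x, 'y, 'u) xhat"

type_synonym ('x, 'u, 'y) hhat =
  "nat \<Rightarrow> nat \<Rightarrow> ('x, 'y, 'u) xhat \<Rightarrow> (nat \<Rightarrow> ('y, 'u) partial_action) \<Rightarrow> ('y, 'u) realization"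

text \<open>The functions \<open>fh\<close> and \<open>hh\<close> describe the augmented state and the new information. Constant
  laws are partial strategies, so this determines \<open>fh\<close> and \<open>hh\<close> at every augmented state
  reachable under some sequence of partial actions.\<close>

definition model_functions :: "('x, 'u, 'y, 'w, 'v) system \<Rightarrow> ('x, 'u, 'y, 'w, 'v) fhat
    \<Rightarrow> ('x, 'u, 'y) hhat \<Rightarrow> bool" where
  "model_functions S fh hh \<longleftrightarrow>
    (\<forall>gh\<in>partial_strategies S. \<forall>\<omega>\<in>feasible S. \<forall>t<horizon S.
      xhat_run S gh \<omega> (Suc t) =
        fh t (xhat_run S gh \<omega> t) (uhat_run S gh \<omega> t) (disturbance \<omega> t) (noise \<omega> (Suc t)) \<and>
      (\<forall>n\<in>Subs S. z_run S gh \<omega> (Suc t) n = hh t n (xhat_run S gh \<omega> t) (uhat_run S gh \<omega> t)))"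

section \<open>Information states\<close>

text \<open>An element of $\mathcal P_t^n$ is a finite set of pairs of an augmented state and the list
  $[P_t^1,\dots,P_t^{n-1}]$.\<close>

datatype 'a info = Info "('a \<times> 'a info list) fset"

type_synonym ('x, 'y, 'u) xinfo = "('x, 'y, 'u) xhat info"

text \<open>\<open>\<gamma> l m\<close> is the prescription of subsystem \<open>n\<close> for subsystem \<open>m < n\<close> at time \<open>l\<close>, applied to
  the list $[P_l^m,\dots,P_l^{n-1}]$; \<open>a l m\<close> is the partial action of subsystem \<open>m \<ge> n\<close>; and
  \<open>z l\<close> is the new information of subsystem \<open>n\<close> at time \<open>l + 1\<close>. Only indices \<open>l < t\<close> matter.
  Since the primitive variables range over a product of non-empty sets, taking values for the
  whole horizon instead of the values up to time \<open>t\<close> yields the same set. The set is finite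
  (\<open>info_state_members\<close> below), so that forming the finite set is justified.\<close>

function info_state :: "('x, 'u, 'y, 'w, 'v) system \<Rightarrow> ('x, 'u, 'y, 'w, 'v) fhat
    \<Rightarrow> ('x, 'u, 'y) hhat \<Rightarrow> nat \<Rightarrow> nat \<Rightarrow> (nat \<Rightarrow> ('y, 'u) realization)
    \<Rightarrow> (nat \<Rightarrow> nat \<Rightarrow> ('x, 'y, 'u) xinfo list \<Rightarrow> ('y, 'u) partial_action)
    \<Rightarrow> (nat \<Rightarrow> nat \<Rightarrow> ('y, 'u) partial_action) \<Rightarrow> ('x, 'y, 'u) xinfo" where
  "info_state S fh hh n t z \<gamma> a = Info (Abs_fset
    {(xh t, map (P t) [1..<n]) | \<omega> xh uh P.
       \<omega> \<in> feasible S \<and>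
       xh 0 = augment S \<omega> 0 (init_state \<omega>, \<lambda>_. undefined) \<and>
       (\<forall>l<t. uh l = (\<lambda>m\<in>Subs S. if m < n then \<gamma> l m (map (P l) [m..<n]) else a l m) \<and>
              xh (Suc l) = fh l (xh l) (uh l) (disturbance \<omega> l) (noise \<omega> (Suc l)) \<and>
              z l = hh l n (xh l) (uh l)) \<and>
       (\<forall>l\<le>t. \<forall>m\<in>{1..<n}. P l m =
          info_state S fh hh m l
            (\<lambda>j. hh j m (xh j) (uh j))
            (\<lambda>j i Ps. \<gamma> j i (Ps @ map (P j) [m..<n]))
            uh)})"
  by pat_completeness auto
termination
  by (relation "measure (\<lambda>(S, fh, hh, n, t, z, \<gamma>, a). n)") auto

declare info_state.simps [simp del]

lemma info_state_cong:
  fixes S :: "('x, 'u, 'y, 'w, 'v) system"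
  assumes "\<And>l. l < t \<Longrightarrow> z l = z' l" "\<And>l. l < t \<Longrightarrow> \<gamma> l = \<gamma>' l" "\<And>l. l < t \<Longrightarrow> a l = a' l"
  shows "info_state S fh hh n t z \<gamma> a = info_state S fh hh n t z' \<gamma>' a'"
proof -
  define Q where "Q n \<longleftrightarrow> (\<forall>t z z' \<gamma> \<gamma>' a a'.
      (\<forall>l<t. z l = z' l \<and> \<gamma> l = \<gamma>' l \<and> a l = a' l) \<longrightarrow>
      info_state S fh hh n t z \<gamma> a = info_state S fh hh n t z' \<gamma>' a')" for n
  have "Q n"
  proof (induction n rule: less_induct)
    case (less n)
    show ?case unfolding Q_def
    proof (intro allI impI)
      fix t :: nat and z z' :: "nat \<Rightarrow> ('y, 'u) realization"
        and \<gamma> \<gamma>' :: "nat \<Rightarrow> nat \<Rightarrow> ('x, 'y, 'u) xinfo list \<Rightarrow> ('y, 'u) partial_action"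
        and a a' :: "nat \<Rightarrow> nat \<Rightarrow> ('y, 'u) partial_action"
      assume agree: "\<forall>l<t. z l = z' l \<and> \<gamma> l = \<gamma>' l \<and> a l = a' l"
      have inner: "info_state S fh hh m l (\<lambda>j. hh j m (xh j) (uh j))
            (\<lambda>j i Ps. \<gamma> j i (Ps @ map (P j) [m..<n])) uh =
          info_state S fh hh m l (\<lambda>j. hh j m (xh j) (uh j))
            (\<lambda>j i Ps. \<gamma>' j i (Ps @ map (P j) [m..<n])) uh"
        if "l \<le> t" "m \<in> {1..<n}" for m l xh uh P
        using that agree by (intro less.IH[unfolded Q_def, rule_format]) auto
      show "info_state S fh hh n t z \<gamma> a = info_state S fh hh n t z' \<gamma>' a'"
        unfolding info_state.simps[of S fh hh n t]
        by (intro arg_cong[where f = Info] arg_cong[where f = Abs_fset] Collect_cong ex_cong1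
            conj_cong refl all_cong ball_cong imp_cong)
          (use agree inner in \<open>simp_all cong: if_cong\<close>)
    qed
  qed
  with assms show ?thesis unfolding Q_def by blast
qed

lemma (in nested_system) finite_feasible: "finite (feasible S)"
proof -
  let ?D = "\<Pi>\<^sub>E t\<in>{..horizon S}. disturbances S t"
  let ?V = "\<Pi>\<^sub>E t\<in>{..horizon S}. \<Pi>\<^sub>E n\<in>Subs S. \<Pi>\<^sub>E k\<in>Ags S n. noises S t n k"
  have "finite (states S 0 \<times> ?D \<times> ?V)"
    using states_finite disturbances_finite noises_finite
    by (intro finite_cartesian_product finite_PiE) auto
  then have "finite ((\<lambda>(x, d, v). \<lparr>init_state = x, disturbance = d, noise = v\<rparr>) ` (states S 0 \<times> ?D \<times> ?V))"
    by (rule finite_imageI)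
  moreover have "feasible S \<subseteq> (\<lambda>(x, d, v). \<lparr>init_state = x, disturbance = d, noise = v\<rparr>) ` (states S 0 \<times> ?D \<times> ?V)"
  proof
    fix \<omega> assume "\<omega> \<in> feasible S"
    then show "\<omega> \<in> (\<lambda>(x, d, v). \<lparr>init_state = x, disturbance = d, noise = v\<rparr>) ` (states S 0 \<times> ?D \<times> ?V)"
      unfolding feasible_def by (intro image_eqI[of _ _ "(init_state \<omega>, disturbance \<omega>, noise \<omega>)"]) auto
  qed
  ultimately show ?thesis by (rule rev_finite_subset)
qed

lemma (in nested_system) info_state_members:
  "\<exists>F. info_state S fh hh n t z \<gamma> a = Info F \<and> fset F =
    {(xh t, map (P t) [1..<n]) | \<omega> xh uh P.
       \<omega> \<in> feasible S \<and>
       xh 0 = augment S \<omega> 0 (init_state \<omega>, \<lambda>_. undefined) \<and>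
       (\<forall>l<t. uh l = (\<lambda>m\<in>Subs S. if m < n then \<gamma> l m (map (P l) [m..<n]) else a l m) \<and>
              xh (Suc l) = fh l (xh l) (uh l) (disturbance \<omega> l) (noise \<omega> (Suc l)) \<and>
              z l = hh l n (xh l) (uh l)) \<and>
       (\<forall>l\<le>t. \<forall>m\<in>{1..<n}. P l m =
          info_state S fh hh m l
            (\<lambda>j. hh j m (xh j) (uh j))
            (\<lambda>j i Ps. \<gamma> j i (Ps @ map (P j) [m..<n]))
            uh)}"
proof -
  define R where "R \<omega> xh uh P \<longleftrightarrow>
       \<omega> \<in> feasible S \<and>
       xh 0 = augment S \<omega> 0 (init_state \<omega>, \<lambda>_. undefined) \<and>
       (\<forall>l<t. uh l = (\<lambda>m\<in>Subs S. if m < n then \<gamma> l m (map (P l) [m..<n]) else a l m) \<and>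
              xh (Suc l) = fh l (xh l) (uh l) (disturbance \<omega> l) (noise \<omega> (Suc l)) \<and>
              z l = hh l n (xh l) (uh l)) \<and>
       (\<forall>l\<le>t. \<forall>m\<in>{1..<n}. P l m =
          info_state S fh hh m l
            (\<lambda>j. hh j m (xh j) (uh j))
            (\<lambda>j i Ps. \<gamma> j i (Ps @ map (P j) [m..<n]))
            uh)"
    for \<omega> xh uh P
  have unique: "xh l = xh' l \<and> (\<forall>m\<in>{1..<n}. P l m = P' l m)"
    if R: "R \<omega> xh uh P" and R': "R \<omega> xh' uh' P'" and "l \<le> t" for \<omega> xh xh' uh uh' P P' l
    using \<open>l \<le> t\<close>
  proof (induction l rule: less_induct)
    case (less l)
    have uh: "uh j = uh' j" if "j < l" for j
    proof -
      have eq: "map (P j) [m..<n] = map (P' j) [m..<n]" if "m \<in> Subs S" for m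
        using less.IH[of j] \<open>j < l\<close> less.prems that by auto
      have "j < t" using \<open>j < l\<close> less.prems by simp
      have "(\<lambda>m\<in>Subs S. if m < n then \<gamma> j m (map (P j) [m..<n]) else a j m) =
          (\<lambda>m\<in>Subs S. if m < n then \<gamma> j m (map (P' j) [m..<n]) else a j m)"
        by (intro restrict_ext) (simp only: eq)
      moreover have "uh j = (\<lambda>m\<in>Subs S. if m < n then \<gamma> j m (map (P j) [m..<n]) else a j m)"
        using R \<open>j < t\<close> unfolding R_def by blast
      moreover have "uh' j = (\<lambda>m\<in>Subs S. if m < n then \<gamma> j m (map (P' j) [m..<n]) else a j m)"
        using R' \<open>j < t\<close> unfolding R_def by blast
      ultimately show ?thesis by (simp only:)
    qed
    have xh: "xh l = xh' l"
    proof (cases l)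
      case 0
      then show ?thesis using R R' by (simp add: R_def)
    next
      case (Suc j)
      then show ?thesis using R R' uh[of j] less.IH[of j] less.prems by (simp add: R_def)
    qed
    have "P l m = P' l m" if m: "m \<in> {1..<n}" for m
    proof -
      have "P l m = info_state S fh hh m l (\<lambda>j. hh j m (xh j) (uh j))
            (\<lambda>j i Ps. \<gamma> j i (Ps @ map (P j) [m..<n])) uh"
        using R m less.prems unfolding R_def by blast
      also have "\<dots> = info_state S fh hh m l (\<lambda>j. hh j m (xh' j) (uh' j))
            (\<lambda>j i Ps. \<gamma> j i (Ps @ map (P' j) [m..<n])) uh'"
      proof (rule info_state_cong)
        fix j assume j: "j < l"
        have eq: "map (P j) [m..<n] = map (P' j) [m..<n]"
          using less.IH[of j] j less.prems m by auto
        show "(\<lambda>i Ps. \<gamma> j i (Ps @ map (P j) [m..<n])) = (\<lambda>i Ps. \<gamma> j i (Ps @ map (P' j) [m..<n]))"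
          by (simp only: eq)
        show "hh j m (xh j) (uh j) = hh j m (xh' j) (uh' j)"
          using less.IH[of j] j less.prems uh by simp
      qed (simp add: uh)
      also have "\<dots> = P' l m"
        using R' m less.prems unfolding R_def by force
      finally show ?thesis .
    qed
    with xh show ?case by simp
  qed
  let ?A = "{(xh t, map (P t) [1..<n]) | \<omega> xh uh P. R \<omega> xh uh P}"
  have "finite {(xh t, map (P t) [1..<n]) | xh uh P. R \<omega> xh uh P}" for \<omega>
  proof (cases "\<exists>xh uh P. R \<omega> xh uh P")
    case True
    then obtain xh uh P where R: "R \<omega> xh uh P" by blast
    have "xh' t = xh t \<and> map (P' t) [1..<n] = map (P t) [1..<n]" if "R \<omega> xh' uh' P'" for xh' uh' P'
      using unique[OF that R, of t] by auto
    then have "{(xh t, map (P t) [1..<n]) | xh uh P. R \<omega> xh uh P} \<subseteq> {(xh t, map (P t) [1..<n])}"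
      by blast
    then show ?thesis by (rule finite_subset) simp
  qed simp
  then have "finite (\<Union>\<omega>\<in>feasible S. {(xh t, map (P t) [1..<n]) | xh uh P. R \<omega> xh uh P})"
    using finite_feasible by blast
  moreover have "?A \<subseteq> (\<Union>\<omega>\<in>feasible S. {(xh t, map (P t) [1..<n]) | xh uh P. R \<omega> xh uh P})"
    unfolding R_def by blast
  ultimately have "finite ?A" by (rule rev_finite_subset)
  then have "info_state S fh hh n t z \<gamma> a = Info (Abs_fset ?A) \<and> fset (Abs_fset ?A) = ?A"
    unfolding info_state.simps[of S fh hh n t] R_def by (simp add: Abs_fset_inverse)
  then show ?thesis unfolding R_def by blast
qed

section \<open>Structured strategies\<close>

text \<open>A structured law \<open>\<psi> t n\<close> takes the list $[\Pi_t^n,\dots,\Pi_t^N]$. The information states are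
  functions of the common information \<open>c\<close>: the new information of earlier times and the common
  information of the subsystems \<open>m > n\<close> are restrictions of \<open>c\<close>, since common information is
  nested and never forgotten.\<close>

type_synonym ('x, 'y, 'u) structured_partial =
  "nat \<Rightarrow> nat \<Rightarrow> ('x, 'y, 'u) xinfo list \<Rightarrow> ('y, 'u) partial_action"

function Pi_info :: "('x, 'u, 'y, 'w, 'v) system \<Rightarrow> ('x, 'u, 'y, 'w, 'v) fhat
    \<Rightarrow> ('x, 'u, 'y) hhat \<Rightarrow> ('x, 'y, 'u) structured_partial \<Rightarrow> nat \<Rightarrow> nat
    \<Rightarrow> ('y, 'u) realization \<Rightarrow> ('x, 'y, 'u) xinfo" where
  "Pi_info S fh hh \<psi> t n c = info_state S fh hh n t
    (\<lambda>l. restrict c (new_info S (Suc l) n))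
    (\<lambda>l m Ps. if l < t
       then \<psi> l m (Ps @ map (\<lambda>i. Pi_info S fh hh \<psi> l i c) [n..<Suc (subsystems S)])
       else undefined)
    (\<lambda>l m. if l < t
       then \<psi> l m (map (\<lambda>i. Pi_info S fh hh \<psi> l i c) [m..<Suc (subsystems S)])
       else undefined)"
  by pat_completeness auto
termination
  by (relation "measure (\<lambda>(S, fh, hh, \<psi>, t, n, c). t)") auto

declare Pi_info.simps [simp del]

definition Pi_infos :: "('x, 'u, 'y, 'w, 'v) system \<Rightarrow> ('x, 'u, 'y, 'w, 'v) fhat
    \<Rightarrow> ('x, 'u, 'y) hhat \<Rightarrow> ('x, 'y, 'u) structured_partial \<Rightarrow> nat \<Rightarrow> nat
    \<Rightarrow> ('y, 'u) realization \<Rightarrow> ('x, 'y, 'u) xinfo list" where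
  "Pi_infos S fh hh \<psi> t n c = map (\<lambda>m. Pi_info S fh hh \<psi> t m c) [n..<Suc (subsystems S)]"

definition structured_partials ::
  "('x, 'u, 'y, 'w, 'v) system \<Rightarrow> ('x, 'y, 'u) structured_partial set" where
  "structured_partials S =
    {\<psi>. \<forall>t\<le>horizon S. \<forall>n\<in>Subs S. \<forall>Ps. \<psi> t n Ps \<in> partial_actions S t n}"

definition partial_strategy_of :: "('x, 'u, 'y, 'w, 'v) system \<Rightarrow> ('x, 'u, 'y, 'w, 'v) fhat
    \<Rightarrow> ('x, 'u, 'y) hhat \<Rightarrow> ('x, 'y, 'u) structured_partial \<Rightarrow> ('y, 'u) partial_strategy" where
  "partial_strategy_of S fh hh \<psi> t n c = \<psi> t n (Pi_infos S fh hh \<psi> t n c)"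

type_synonym ('x, 'y, 'u) structured_control =
  "nat \<Rightarrow> nat \<Rightarrow> nat \<Rightarrow> 'y \<Rightarrow> ('y, 'u) realization \<Rightarrow> ('x, 'y, 'u) xinfo list \<Rightarrow> 'u"

definition structured_controls ::
  "('x, 'u, 'y, 'w, 'v) system \<Rightarrow> ('x, 'y, 'u) structured_control set" where
  "structured_controls S = {\<phi>. \<forall>t\<le>horizon S. \<forall>n\<in>Subs S. \<forall>k\<in>Ags S n.
     \<forall>y\<in>observations S t n k. \<forall>l\<in>realizations S (private_info S t n k). \<forall>Ps.
     \<phi> t n k y l Ps \<in> actions S t n k}"

definition partial_of_control :: "('x, 'u, 'y, 'w, 'v) system
    \<Rightarrow> ('x, 'y, 'u) structured_control \<Rightarrow> ('x, 'y, 'u) structured_partial" where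
  "partial_of_control S \<phi> t n Ps = (\<lambda>k\<in>Ags S n.
     \<lambda>(y, l)\<in>observations S t n k \<times> realizations S (private_info S t n k). \<phi> t n k y l Ps)"

definition control_of :: "('x, 'u, 'y, 'w, 'v) system \<Rightarrow> ('x, 'u, 'y, 'w, 'v) fhat
    \<Rightarrow> ('x, 'u, 'y) hhat \<Rightarrow> ('x, 'y, 'u) structured_control \<Rightarrow> ('y, 'u) control" where
  "control_of S fh hh \<phi> t n k y m = \<phi> t n k y (restrict m (private_info S t n k))
     (Pi_infos S fh hh (partial_of_control S \<phi>) t n (restrict m (common_info S t n)))"

end

theory Submission
  imports Defs
begin

text \<open>
  Costs depend only on the set of reachable terminal states, so it suffices to turn an arbitrary
  partial strategy into a structured one whose reachable terminal states are among those of the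
  original. Optimal strategies exist because the costs take finitely many values. The strategy is
  made structured one time step after the other, without any dynamic programming.

  Suppose that \<open>gh\<close> is structured before time \<open>t\<close>. Then the information state of subsystem \<open>n\<close> at
  time \<open>t\<close> has a direct meaning (\<open>info_characterization\<close>): it is the set of all
  $(\hat x_t, \Pi_t^1, \dots, \Pi_t^{n-1})$ that occur on trajectories of \<open>gh\<close> with the given common
  information $c_t^n$. It is thus a nested description of what subsystem \<open>n\<close> believes about the
  augmented state and about the beliefs of the subsystems with more information.

  Consequently two realizations of the common information with the same information state are
  interchangeable, and this can be done in all subsystems at once. Along a trajectory, choose
  first a representative $\bar c_t^N$ of $\Pi_t^N$. Since $\Pi_t^{N-1}$ occurs in $\Pi_t^N$, some
  $\bar c_t^{N-1}$ extends $\bar c_t^N$ and has the information state $\Pi_t^{N-1}$; continue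
  downwards. The choice of $\bar c_t^n$ uses only $\Pi_t^n, \dots, \Pi_t^N$. At the bottom,
  $\hat x_t$ occurs in $\Pi_t^1$, so one trajectory of \<open>gh\<close> has the state $\hat x_t$ and all the
  representatives as its common information (\<open>representatives_realized\<close>).

  Let every subsystem from time \<open>t\<close> on play \<open>gh\<close> as if its common information at time \<open>t\<close> had been
  the representative (\<open>switch\<close>). The new strategy is structured up to and including time \<open>t\<close>.
  Splicing the primitive variables of the representative trajectory before time \<open>t\<close> to the actual
  ones afterwards, which is possible since the primitive variables are independent, gives a
  trajectory of \<open>gh\<close> with the same augmented states from time \<open>t\<close> on (\<open>switch_trajectory\<close>). Hence
  the cost does not increase.

  Control strategies and partial strategies correspond to each other with equal costs, which
  transfers the result to the original problem.
\<close>

section \<open>Congruence rules for information states\<close>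

text \<open>Only the prescriptions for subsystems below \<open>n\<close> and the partial actions of the others enter an
  information state. Comparing the data everywhere, as \<open>info_state_cong\<close> does, would be too
  strict: partial actions along a run are undefined outside the set of subsystems, whereas the
  values of a structured law are not.\<close>

lemma info_state_strong_cong:
  fixes S :: "('x, 'u, 'y, 'w, 'v) system"
  assumes "\<And>l. l < t \<Longrightarrow> z l = z' l"
    and "\<And>l m. \<lbrakk>l < t; m \<in> Subs S; m < n\<rbrakk> \<Longrightarrow> \<gamma> l m = \<gamma>' l m"
    and "\<And>l m. \<lbrakk>l < t; m \<in> Subs S; n \<le> m\<rbrakk> \<Longrightarrow> a l m = a' l m"
  shows "info_state S fh hh n t z \<gamma> a = info_state S fh hh n t z' \<gamma>' a'"
proof -
  \<comment> \<open>A closed formula keeps the function-valued parameters out of the higher-order unification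
    of the induction rule.\<close>
  define Q where "Q n \<longleftrightarrow> (\<forall>t z z' \<gamma> \<gamma>' a a'.
      (\<forall>l<t. z l = z' l \<and> (\<forall>m\<in>Subs S. if m < n then \<gamma> l m = \<gamma>' l m else a l m = a' l m)) \<longrightarrow>
      info_state S fh hh n t z \<gamma> a = info_state S fh hh n t z' \<gamma>' a')" for n
  have "Q n"
  proof (induction n rule: less_induct)
    case (less n)
    show ?case unfolding Q_def
    proof (intro allI impI)
      fix t :: nat and z z' :: "nat \<Rightarrow> ('y, 'u) realization"
        and \<gamma> \<gamma>' :: "nat \<Rightarrow> nat \<Rightarrow> ('x, 'y, 'u) xinfo list \<Rightarrow> ('y, 'u) partial_action"
        and a a' :: "nat \<Rightarrow> nat \<Rightarrow> ('y, 'u) partial_action"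
      assume agree: "\<forall>l<t. z l = z' l \<and>
        (\<forall>m\<in>Subs S. if m < n then \<gamma> l m = \<gamma>' l m else a l m = a' l m)"
      have uh: "(\<lambda>m\<in>Subs S. if m < n then \<gamma> l m (X m) else a l m) =
          (\<lambda>m\<in>Subs S. if m < n then \<gamma>' l m (X m) else a' l m)" if "l < t" for l X
        using that agree by (intro restrict_ext) (auto split: if_splits)
      have inner: "info_state S fh hh m l (\<lambda>j. hh j m (xh j) (uh j))
            (\<lambda>j i Ps. \<gamma> j i (Ps @ map (P j) [m..<n])) uh =
          info_state S fh hh m l (\<lambda>j. hh j m (xh j) (uh j))
            (\<lambda>j i Ps. \<gamma>' j i (Ps @ map (P j) [m..<n])) uh"
        if "l \<le> t" "m \<in> {1..<n}" for m l xh uh P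
      proof (rule less.IH[unfolded Q_def, rule_format])
        show "m < n" using that by simp
        fix j assume "j < l"
        then have "\<gamma> j i = \<gamma>' j i" if "i \<in> Subs S" "i < m" for i
          using agree that \<open>l \<le> t\<close> \<open>m \<in> {1..<n}\<close> by (auto split: if_splits)
        then show "hh j m (xh j) (uh j) = hh j m (xh j) (uh j) \<and>
            (\<forall>i\<in>Subs S. if i < m
              then (\<lambda>Ps. \<gamma> j i (Ps @ map (P j) [m..<n])) = (\<lambda>Ps. \<gamma>' j i (Ps @ map (P j) [m..<n]))
              else uh j i = uh j i)"
          by simp
      qed
      show "info_state S fh hh n t z \<gamma> a = info_state S fh hh n t z' \<gamma>' a'"
        unfolding info_state.simps[of S fh hh n t]
        by (intro arg_cong[where f = Info] arg_cong[where f = Abs_fset] Collect_cong ex_cong1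
            conj_cong refl all_cong ball_cong imp_cong)
          (use agree uh inner in \<open>simp_all only:\<close>)
    qed
  qed
  with assms show ?thesis unfolding Q_def by simp
qed

text \<open>This rule serves both to change the law at times that do not matter yet and to replace the
  common information by what an earlier time or a subsystem with less information knows.\<close>

lemma Pi_info_cong:
  fixes S :: "('x, 'u, 'y, 'w, 'v) system"
  assumes "n \<in> Subs S"
    and "\<And>l m. \<lbrakk>l < t; m \<in> Subs S\<rbrakk> \<Longrightarrow> \<psi> l m = \<psi>' l m"
    and "\<And>l m. \<lbrakk>l < t; m \<in> Subs S; n \<le> m\<rbrakk>
      \<Longrightarrow> restrict c (new_info S (Suc l) m) = restrict c' (new_info S (Suc l) m)"
  shows "Pi_info S fh hh \<psi> t n c = Pi_info S fh hh \<psi>' t n c'"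
  using assms
proof (induction t arbitrary: n rule: less_induct)
  case (less t)
  have IH: "map (\<lambda>i. Pi_info S fh hh \<psi> l i c) [m..<Suc (subsystems S)] =
      map (\<lambda>i. Pi_info S fh hh \<psi>' l i c') [m..<Suc (subsystems S)]" if "l < t" "n \<le> m" for l m
    using that less.prems by (intro map_cong refl less.IH) auto
  show ?case
    unfolding Pi_info.simps[of S fh hh _ t]
  proof (rule info_state_strong_cong)
    show "restrict c (new_info S (Suc l) n) = restrict c' (new_info S (Suc l) n)" if "l < t" for l
      using less.prems(1) by (intro less.prems(3) that) auto
  qed (use less.prems(2) IH in \<open>simp_all del: upt_Suc map_eq_conv\<close>)
qed

section \<open>Labels and common information\<close>

context nested_system
begin

definition past_labels :: "nat \<Rightarrow> label set" where
  "past_labels t = {Obs s m i | s m i. s < t \<and> m \<in> Subs S \<and> i \<in> Ags S m} \<union>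
     {Act s m i | s m i. s < t \<and> m \<in> Subs S \<and> i \<in> Ags S m}"

lemma memory_past:
  assumes "t \<le> horizon S" "n \<in> Subs S" "k \<in> Ags S n"
  shows "memory S t n k \<subseteq> past_labels t"
  using memory_nested[OF assms] unfolding past_labels_def by blast

lemma common_info_memory: "k \<in> Ags S n \<Longrightarrow> common_info S t n \<subseteq> memory S t n k"
  unfolding common_info_def by blast

lemma common_info_past:
  assumes "t \<le> horizon S" "n \<in> Subs S"
  shows "common_info S t n \<subseteq> past_labels t"
proof -
  have "1 \<in> Ags S n" using agents_pos[OF assms(2)] by simp
  then show ?thesis using memory_past[OF assms] common_info_memory by blast
qed

lemma common_info_0: "n \<in> Subs S \<Longrightarrow> common_info S 0 n = {}"
  using common_info_past[of 0 n] by (auto simp: past_labels_def)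

lemma common_info_mono_time:
  assumes "s \<le> t" "t \<le> horizon S" "n \<in> Subs S"
  shows "common_info S s n \<subseteq> common_info S t n"
  using assms(1,2)
proof (induction t rule: dec_induct)
  case (step t)
  then show ?case using common_recall[of t n] assms(3) by simp
qed simp

lemma common_info_mono:
  assumes "s \<le> t" "t \<le> horizon S" "n \<in> Subs S" "m \<in> Subs S" "n \<le> m"
  shows "common_info S s m \<subseteq> common_info S t n"
proof -
  have "common_info S s m \<subseteq> common_info S s n"
    using common_nested[of s n m] assms by (cases "n = m") auto
  then show ?thesis using common_info_mono_time[OF assms(1-3)] by blast
qed

lemma common_info_Suc:
  assumes "t < horizon S" "n \<in> Subs S"
  shows "common_info S (Suc t) n = common_info S t n \<union> new_info S (Suc t) n"
  using common_recall[OF assms] by (auto simp: new_info_def)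

lemma new_info_subset: "new_info S t n \<subseteq> common_info S t n"
  by (auto simp: new_info_def)

text \<open>Common information starts empty and is never forgotten, so the new information of all times
  determines it.\<close>

lemma restrict_common_info_eqI:
  assumes "t \<le> horizon S" "n \<in> Subs S"
    and "\<And>l. l < t \<Longrightarrow> restrict c (new_info S (Suc l) n) = restrict c' (new_info S (Suc l) n)"
  shows "restrict c (common_info S t n) = restrict c' (common_info S t n)"
  using assms(1,3)
proof (induction t)
  case 0
  then show ?case using common_info_0[OF assms(2)] by simp
next
  case (Suc t)
  have *: "c a = c' a" if "a \<in> common_info S t n" for a
    using Suc that by (metis Suc_leD less_SucI restrict_apply')
  have "c a = c' a" if "a \<in> new_info S (Suc t) n" for a
    using Suc.prems(2)[of t] that by (metis lessI restrict_apply')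
  with * common_info_Suc[of t n] Suc.prems(1) assms(2) show ?case
    by (intro restrict_ext) auto
qed

section \<open>Runs of control strategies\<close>

lemma run_Suc:
  "fst (run S g \<omega> (Suc t)) = dynamics S t (fst (run S g \<omega> t))
     (\<lambda>n\<in>Subs S. \<lambda>k\<in>Ags S n. g t n k (sensor S t n k (fst (run S g \<omega> t)) (noise \<omega> t n k))
        (restrict (snd (run S g \<omega> t)) (memory S t n k))) (disturbance \<omega> t)"
  "snd (run S g \<omega> (Suc t)) = extend_history t
     (\<lambda>n k. sensor S t n k (fst (run S g \<omega> t)) (noise \<omega> t n k))
     (\<lambda>n k. g t n k (sensor S t n k (fst (run S g \<omega> t)) (noise \<omega> t n k))
        (restrict (snd (run S g \<omega> t)) (memory S t n k))) (snd (run S g \<omega> t))"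
  by (simp_all add: split_beta Let_def)

lemma extend_history_past:
  "a \<in> past_labels t \<Longrightarrow> extend_history t y u H a = H a"
  by (auto simp: past_labels_def extend_history_def)

lemma past_labels_Suc_cases:
  assumes "a \<in> past_labels (Suc t)"
  obtains "a \<in> past_labels t"
  | n k where "a = Obs t n k" "n \<in> Subs S" "k \<in> Ags S n"
  | n k where "a = Act t n k" "n \<in> Subs S" "k \<in> Ags S n"
  using assms unfolding past_labels_def by (auto simp: less_Suc_eq)

lemma past_labels_mono: "s \<le> t \<Longrightarrow> past_labels s \<subseteq> past_labels t"
  by (fastforce simp: past_labels_def)

lemma history_stable:
  assumes "s \<le> t" "a \<in> past_labels s"
  shows "snd (run S g \<omega> t) a = snd (run S g \<omega> s) a"
  using assms(1)
proof (induction t rule: dec_induct)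
  case (step t)
  then have "a \<in> past_labels t" using assms(2) past_labels_mono by blast
  then show ?case using step.IH by (simp add: run_Suc extend_history_past del: run.simps)
qed simp

lemma noise_mem:
  "\<lbrakk>\<omega> \<in> feasible S; t \<le> horizon S; n \<in> Subs S; k \<in> Ags S n\<rbrakk> \<Longrightarrow> noise \<omega> t n k \<in> noises S t n k"
  by (fastforce simp: feasible_def PiE_iff)

lemma disturbance_mem:
  "\<lbrakk>\<omega> \<in> feasible S; t \<le> horizon S\<rbrakk> \<Longrightarrow> disturbance \<omega> t \<in> disturbances S t"
  by (fastforce simp: feasible_def PiE_iff)

lemma restrict_realization:
  "(\<And>a. a \<in> A \<Longrightarrow> H a \<in> label_values S a) \<Longrightarrow> restrict H A \<in> realizations S A"
  by (auto simp: realizations_def)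

lemma controls_mem:
  "\<lbrakk>g \<in> controls S; t \<le> horizon S; n \<in> Subs S; k \<in> Ags S n; y \<in> observations S t n k;
    m \<in> realizations S (memory S t n k)\<rbrakk> \<Longrightarrow> g t n k y m \<in> actions S t n k"
  by (auto simp: controls_def)

lemma run_feasible:
  assumes "g \<in> controls S" "\<omega> \<in> feasible S" "t \<le> horizon S"
  shows "fst (run S g \<omega> t) \<in> states S t \<and>
    (\<forall>a\<in>past_labels t. snd (run S g \<omega> t) a \<in> label_values S a)"
  using assms(3)
proof (induction t)
  case 0
  then show ?case using assms(2) by (auto simp: feasible_def past_labels_def)
next
  case (Suc t)
  let ?x = "fst (run S g \<omega> t)" and ?H = "snd (run S g \<omega> t)"
  let ?y = "\<lambda>n k. sensor S t n k ?x (noise \<omega> t n k)"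
  let ?u = "\<lambda>n k. g t n k (?y n k) (restrict ?H (memory S t n k))"
  have IH: "?x \<in> states S t" "\<And>a. a \<in> past_labels t \<Longrightarrow> ?H a \<in> label_values S a"
    using Suc by auto
  have y: "?y n k \<in> observations S t n k" if "n \<in> Subs S" "k \<in> Ags S n" for n k
    using that Suc.prems IH(1) assms(2) by (intro sensor_closed noise_mem) auto
  have u: "?u n k \<in> actions S t n k" if "n \<in> Subs S" "k \<in> Ags S n" for n k
    using that Suc.prems y[OF that] memory_past[of t n k] IH(2)
    by (intro controls_mem[OF assms(1)] restrict_realization) auto
  have "fst (run S g \<omega> (Suc t)) \<in> states S (Suc t)"
    unfolding run_Suc using Suc.prems u IH(1) disturbance_mem[OF assms(2), of t]
    by (intro dynamics_closed) (simp_all del: run.simps)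
  moreover have "snd (run S g \<omega> (Suc t)) a \<in> label_values S a" if "a \<in> past_labels (Suc t)" for a
    using that
  proof (cases rule: past_labels_Suc_cases)
    case 1
    then show ?thesis unfolding run_Suc using IH(2) by (simp add: extend_history_past)
  next
    case (2 n k)
    then show ?thesis unfolding run_Suc using y by (simp add: extend_history_def)
  next
    case (3 n k)
    then show ?thesis unfolding run_Suc using u by (simp add: extend_history_def)
  qed
  ultimately show ?case by blast
qed

lemma restrict_run_realization:
  assumes "g \<in> controls S" "\<omega> \<in> feasible S" "t \<le> horizon S" "A \<subseteq> past_labels t"
  shows "restrict (snd (run S g \<omega> t)) A \<in> realizations S A"
  using run_feasible[OF assms(1-3)] assms(4) by (intro restrict_realization) auto

text \<open>The run also records meaningless actions of agents that do not exist, and a control law may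
  differ there. The histories therefore agree only on the labels of existing agents, which is all
  that memories contain.\<close>

lemma run_cong:
  assumes "g \<in> controls S" "\<omega> \<in> feasible S" "t \<le> horizon S"
    and "\<And>s n k y m. \<lbrakk>s < t; n \<in> Subs S; k \<in> Ags S n; y \<in> observations S s n k;
      m \<in> realizations S (memory S s n k)\<rbrakk> \<Longrightarrow> g s n k y m = g' s n k y m"
  shows "fst (run S g \<omega> t) = fst (run S g' \<omega> t) \<and>
    (\<forall>a\<in>past_labels t. snd (run S g \<omega> t) a = snd (run S g' \<omega> t) a)"
  using assms(3,4)
proof (induction t)
  case 0
  then show ?case by simp
next
  case (Suc t)
  let ?x = "fst (run S g \<omega> t)" and ?H = "snd (run S g \<omega> t)"
  let ?y = "\<lambda>n k. sensor S t n k ?x (noise \<omega> t n k)"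
  let ?H' = "snd (run S g' \<omega> t)"
  have IH: "fst (run S g' \<omega> t) = ?x" "\<And>a. a \<in> past_labels t \<Longrightarrow> ?H' a = ?H a"
    using Suc by auto
  have u: "g' t n k (?y n k) (restrict ?H' (memory S t n k)) =
      g t n k (?y n k) (restrict ?H (memory S t n k))" if "n \<in> Subs S" "k \<in> Ags S n" for n k
  proof -
    have mem: "memory S t n k \<subseteq> past_labels t" using memory_past that Suc.prems(1) by simp
    then have "restrict ?H' (memory S t n k) = restrict ?H (memory S t n k)"
      using IH(2) by (intro restrict_ext) auto
    moreover have "?y n k \<in> observations S t n k"
      using that Suc.prems(1) run_feasible[OF assms(1,2), of t] assms(2)
      by (intro sensor_closed noise_mem) auto
    ultimately show ?thesis
      using Suc.prems(2)[OF lessI that _ restrict_run_realization[OF assms(1,2) _ mem]] Suc.prems(1)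
      by (simp only:)
  qed
  have "fst (run S g \<omega> (Suc t)) = fst (run S g' \<omega> (Suc t))"
    unfolding run_Suc IH(1) using u by (simp cong: restrict_cong)
  moreover have "snd (run S g \<omega> (Suc t)) a = snd (run S g' \<omega> (Suc t)) a"
    if "a \<in> past_labels (Suc t)" for a
    using that
  proof (cases rule: past_labels_Suc_cases)
    case 1
    then show ?thesis unfolding run_Suc using IH(2) by (simp add: extend_history_past)
  next
    case (2 n k)
    then show ?thesis unfolding run_Suc using IH(1) by (simp add: extend_history_def)
  next
    case (3 n k)
    then show ?thesis unfolding run_Suc using IH(1) u by (simp add: extend_history_def)
  qed
  ultimately show ?case by blast
qed

section \<open>Costs\<close>

lemma J_cong:
  assumes "g \<in> controls S"
    and "\<And>s n k y m. \<lbrakk>s < horizon S; n \<in> Subs S; k \<in> Ags S n; y \<in> observations S s n k;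
      m \<in> realizations S (memory S s n k)\<rbrakk> \<Longrightarrow> g s n k y m = g' s n k y m"
  shows "J S g = J S g'"
  unfolding J_def using run_cong[OF assms(1) _ order_refl assms(2)] by (simp cong: image_cong)

lemma Jhat_J: "Jhat S gh = J S (induced_control S gh)"
  by (simp add: Jhat_def J_def terminal_cost_hat_def xhat_run_def augment_def split_beta)

lemma induced_control_mem:
  assumes "gh \<in> partial_strategies S"
  shows "induced_control S gh \<in> controls S"
  unfolding controls_def mem_Collect_eq
proof (intro allI impI ballI)
  fix t n k y m assume *: "t \<le> horizon S" "n \<in> Subs S" "k \<in> Ags S n"
    "y \<in> observations S t n k" "m \<in> realizations S (memory S t n k)"
  have m: "\<And>a. a \<in> memory S t n k \<Longrightarrow> m a \<in> label_values S a"
    using *(5) by (auto simp: realizations_def)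
  have "restrict m (common_info S t n) \<in> realizations S (common_info S t n)"
    using m common_info_memory[OF *(3)] by (intro restrict_realization) auto
  then have "gh t n (restrict m (common_info S t n)) \<in> partial_actions S t n"
    using assms *(1,2) by (auto simp: partial_strategies_def)
  moreover have "restrict m (private_info S t n k) \<in> realizations S (private_info S t n k)"
    using m by (intro restrict_realization) (auto simp: private_info_def)
  ultimately show "induced_control S gh t n k y m \<in> actions S t n k"
    unfolding induced_control_def partial_actions_def using *(3,4) by (auto simp: PiE_iff)
qed

lemma feasible_nonempty: "feasible S \<noteq> {}"
proof -
  let ?D = "\<Pi>\<^sub>E t\<in>{..horizon S}. disturbances S t"
  let ?V = "\<Pi>\<^sub>E t\<in>{..horizon S}. \<Pi>\<^sub>E n\<in>Subs S. \<Pi>\<^sub>E k\<in>Ags S n. noises S t n k"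
  have "?D \<noteq> {}" "?V \<noteq> {}" "states S 0 \<noteq> {}"
    using states_finite disturbances_finite noises_finite by (auto simp: PiE_eq_empty_iff)
  then obtain x d v where "x \<in> states S 0" "d \<in> ?D" "v \<in> ?V" by blast
  then have "\<lparr>init_state = x, disturbance = d, noise = v\<rparr> \<in> feasible S"
    by (simp add: feasible_def)
  then show ?thesis by blast
qed

text \<open>This bounds the possible costs by a finite set, so that optimal strategies exist.\<close>

lemma J_attained:
  assumes "g \<in> controls S"
  shows "J S g \<in> terminal_cost S ` states S (horizon S)"
proof -
  have "J S g \<in> (\<lambda>\<omega>. terminal_cost S (fst (run S g \<omega> (horizon S)))) ` feasible S"
    unfolding J_def using finite_feasible feasible_nonempty by (intro Max_in) auto
  then show ?thesis using run_feasible[OF assms] by auto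
qed

end

section \<open>Structured laws along a run\<close>

locale modelled_system = nested_system S for S :: "('x, 'u, 'y, 'w, 'v) system" +
  fixes fh :: "('x, 'u, 'y, 'w, 'v) fhat" and hh :: "('x, 'u, 'y) hhat"
  assumes model: "model_functions S fh hh"
begin

abbreviation hist :: "('y, 'u) partial_strategy \<Rightarrow> ('x, 'w, 'v) primitives \<Rightarrow> nat
    \<Rightarrow> ('y, 'u) realization" where
  "hist gh \<omega> t \<equiv> snd (run S (induced_control S gh) \<omega> t)"

definition cinfo :: "('y, 'u) partial_strategy \<Rightarrow> ('x, 'w, 'v) primitives \<Rightarrow> nat \<Rightarrow> nat
    \<Rightarrow> ('y, 'u) realization" where
  "cinfo gh \<omega> t n = restrict (hist gh \<omega> t) (common_info S t n)"

abbreviation info :: "('x, 'y, 'u) structured_partial \<Rightarrow> ('y, 'u) partial_strategy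
    \<Rightarrow> ('x, 'w, 'v) primitives \<Rightarrow> nat \<Rightarrow> nat \<Rightarrow> ('x, 'y, 'u) xinfo" where
  "info \<psi> gh \<omega> t n \<equiv> Pi_info S fh hh \<psi> t n (cinfo gh \<omega> t n)"

abbreviation infos :: "('x, 'y, 'u) structured_partial \<Rightarrow> ('y, 'u) partial_strategy
    \<Rightarrow> ('x, 'w, 'v) primitives \<Rightarrow> nat \<Rightarrow> nat \<Rightarrow> ('x, 'y, 'u) xinfo list" where
  "infos \<psi> gh \<omega> t n \<equiv> map (info \<psi> gh \<omega> t) [n..<Suc (subsystems S)]"

text \<open>The time bound is strict: information states at time \<open>t\<close> depend on the law before \<open>t\<close> only.\<close>

definition follows :: "('y, 'u) partial_strategy \<Rightarrow> ('x, 'y, 'u) structured_partial \<Rightarrow> nat \<Rightarrow> bool"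
  where
  "follows gh \<psi> t \<longleftrightarrow> (\<forall>s<t. \<forall>n\<in>Subs S. \<forall>c. gh s n c = partial_strategy_of S fh hh \<psi> s n c)"

lemma uhat_run_cinfo: "uhat_run S gh \<omega> t = (\<lambda>n\<in>Subs S. gh t n (cinfo gh \<omega> t n))"
  by (simp add: uhat_run_def cinfo_def)

lemma cinfo_restrict:
  assumes "s \<le> t" "t \<le> horizon S" "n \<in> Subs S" "m \<in> Subs S" "n \<le> m"
  shows "restrict (cinfo gh \<omega> t n) (common_info S s m) = cinfo gh \<omega> s m"
proof -
  have "hist gh \<omega> t a = hist gh \<omega> s a" "a \<in> common_info S t n" if "a \<in> common_info S s m" for a
    using that common_info_mono[OF assms] history_stable[OF assms(1)] common_info_past[of s m] assms
    by auto
  then show ?thesis unfolding cinfo_def by (intro ext) (auto simp: restrict_def)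
qed

lemma cinfo_new_info:
  assumes "l < t" "t \<le> horizon S" "n \<in> Subs S" "m \<in> Subs S" "n \<le> m"
  shows "restrict (cinfo gh \<omega> t n) (new_info S (Suc l) m) = z_run S gh \<omega> (Suc l) m"
proof -
  have "restrict (cinfo gh \<omega> t n) (new_info S (Suc l) m) =
      restrict (restrict (cinfo gh \<omega> t n) (common_info S (Suc l) m)) (new_info S (Suc l) m)"
    using new_info_subset[of "Suc l" m] by (simp add: Int_absorb1)
  also have "\<dots> = z_run S gh \<omega> (Suc l) m"
    using assms new_info_subset[of "Suc l" m]
    by (subst cinfo_restrict) (auto simp: cinfo_def z_run_def Int_absorb1)
  finally show ?thesis .
qed

text \<open>A subsystem with more information can compute the information states of those with less.\<close>

lemma Pi_info_restrict:
  assumes "t \<le> horizon S" "n \<in> Subs S" "m \<in> Subs S" "n \<le> m"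
  shows "Pi_info S fh hh \<psi> t m (restrict c (common_info S t n)) = Pi_info S fh hh \<psi> t m c"
proof (rule Pi_info_cong[OF assms(3)])
  fix l q assume *: "l < t" "q \<in> Subs S" "m \<le> q"
  then have "new_info S (Suc l) q \<subseteq> common_info S t n"
    using new_info_subset common_info_mono[of "Suc l" t n q] assms by fastforce
  then show "restrict (restrict c (common_info S t n)) (new_info S (Suc l) q) =
      restrict c (new_info S (Suc l) q)"
    by (simp add: Int_absorb1)
qed simp

lemma Pi_info_past:
  assumes "s \<le> t" "t \<le> horizon S" "n \<in> Subs S" "m \<in> Subs S" "n \<le> m"
  shows "Pi_info S fh hh \<psi> s m (cinfo gh \<omega> t n) = info \<psi> gh \<omega> s m"
  using Pi_info_restrict[of s m m \<psi> "cinfo gh \<omega> t n"] cinfo_restrict[OF assms] assms by simp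

lemma Pi_infos_past:
  assumes "s \<le> t" "t \<le> horizon S" "n \<in> Subs S" "n \<le> m"
  shows "map (\<lambda>i. Pi_info S fh hh \<psi> s i (cinfo gh \<omega> t n)) [m..<Suc (subsystems S)] = infos \<psi> gh \<omega> s m"
  using assms by (intro map_cong refl Pi_info_past) auto

lemma follows_uhat_run:
  assumes "follows gh \<psi> t" "s < t" "t \<le> horizon S" "n \<in> Subs S"
  shows "uhat_run S gh \<omega> s n = \<psi> s n (infos \<psi> gh \<omega> s n)"
proof -
  have "uhat_run S gh \<omega> s n = \<psi> s n (Pi_infos S fh hh \<psi> s n (cinfo gh \<omega> s n))"
    using assms by (simp add: uhat_run_cinfo follows_def partial_strategy_of_def)
  then show ?thesis
    unfolding Pi_infos_def using Pi_infos_past[of s s n n] assms by (simp del: upt_Suc map_eq_conv)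
qed

lemma model_step:
  assumes "gh \<in> partial_strategies S" "\<omega> \<in> feasible S" "t < horizon S"
  shows "xhat_run S gh \<omega> (Suc t) =
      fh t (xhat_run S gh \<omega> t) (uhat_run S gh \<omega> t) (disturbance \<omega> t) (noise \<omega> (Suc t))"
    and "n \<in> Subs S \<Longrightarrow> z_run S gh \<omega> (Suc t) n = hh t n (xhat_run S gh \<omega> t) (uhat_run S gh \<omega> t)"
  using model assms unfolding model_functions_def by blast+

lemma map_upt_split:
  assumes "m \<le> n" "n \<le> k" "\<And>i. \<lbrakk>m \<le> i; i < n\<rbrakk> \<Longrightarrow> f i = h i" "\<And>i. \<lbrakk>n \<le> i; i < k\<rbrakk> \<Longrightarrow> g i = h i"
  shows "map f [m..<n] @ map g [n..<k] = map h [m..<k]"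
proof -
  have "[m..<k] = [m..<n] @ [n..<k]"
    using upt_add_eq_append[of m n "k - n"] assms(1,2) by simp
  then show ?thesis using assms(3,4) by simp
qed

section \<open>The meaning of information states\<close>

text \<open>In the definition of the information state of subsystem \<open>n\<close>, this is the information state
  attributed to a subsystem \<open>m < n\<close> along a candidate trajectory. It is the actual one of \<open>m\<close> as long
  as the candidate agrees with the run on \<open>\<omega>\<close> at earlier times: the prescriptions for \<open>m\<close>'s use are
  those of \<open>n\<close> completed by $P_i^m, \dots, P_i^{n-1}$, and the structured law is recovered by
  concatenating the two lists.\<close>

lemma attributed_info:
  assumes "follows gh \<psi> t" "t \<le> horizon S" "n \<in> Subs S" "m \<in> {1..<n}" "j \<le> t"
    and P: "\<And>i q. \<lbrakk>i < j; q \<in> {1..<n}\<rbrakk> \<Longrightarrow> P i q = info \<psi> gh \<omega> i q"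
    and c: "\<And>i q. \<lbrakk>i < j; q \<in> Subs S; n \<le> q\<rbrakk> \<Longrightarrow> Pi_info S fh hh \<psi> i q c = info \<psi> gh \<omega> i q"
    and z: "\<And>i. i < j \<Longrightarrow> z i = z_run S gh \<omega> (Suc i) m"
    and uh: "\<And>i. i < j \<Longrightarrow> uh i = uhat_run S gh \<omega> i"
  shows "info_state S fh hh m j z
     (\<lambda>i q Ps. if i < t
        then \<psi> i q ((Ps @ map (P i) [m..<n]) @ map (\<lambda>r. Pi_info S fh hh \<psi> i r c) [n..<Suc (subsystems S)])
        else undefined) uh = info \<psi> gh \<omega> j m"
  unfolding Pi_info.simps[of S fh hh \<psi> j]
proof (rule info_state_strong_cong)
  have m: "m \<in> Subs S" using assms(3,4) by auto
  fix i assume i: "i < j"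
  show "z i = restrict (cinfo gh \<omega> j m) (new_info S (Suc i) m)"
    using z[OF i] cinfo_new_info[of i j m m gh \<omega>] i m assms(2,5) by simp
  have split: "map (P i) [m..<n] @ map (\<lambda>r. Pi_info S fh hh \<psi> i r c) [n..<Suc (subsystems S)] =
      infos \<psi> gh \<omega> i m"
    using assms(3,4) P[OF i] c[OF i] by (intro map_upt_split) auto
  have past: "map (\<lambda>r. Pi_info S fh hh \<psi> i r (cinfo gh \<omega> j m)) [q..<Suc (subsystems S)] =
      infos \<psi> gh \<omega> i q" if "m \<le> q" for q
    using i m assms(2,5) that by (intro Pi_infos_past) auto
  fix q assume q: "q \<in> Subs S"
  show "(\<lambda>Ps. if i < t
        then \<psi> i q ((Ps @ map (P i) [m..<n]) @ map (\<lambda>r. Pi_info S fh hh \<psi> i r c) [n..<Suc (subsystems S)])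
        else undefined) =
      (\<lambda>Ps. if i < j
        then \<psi> i q (Ps @ map (\<lambda>r. Pi_info S fh hh \<psi> i r (cinfo gh \<omega> j m)) [m..<Suc (subsystems S)])
        else undefined)"
    unfolding append_assoc split past[OF order_refl] using i assms(5) by (intro ext) simp
  show "uh i q = (if i < j
      then \<psi> i q (map (\<lambda>r. Pi_info S fh hh \<psi> i r (cinfo gh \<omega> j m)) [q..<Suc (subsystems S)])
      else undefined)" if "m \<le> q"
    unfolding past[OF that] uh[OF i] using follows_uhat_run[OF assms(1) _ assms(2) q] i assms(5) by simp
qed

text \<open>The set defining an information state quantifies over candidate trajectories that are
  consistent with the law, the data \<open>c\<close> and the information states attributed to the other
  subsystems. A simultaneous induction over time shows that such a candidate is the run of \<open>gh\<close> on
  its primitive variables and reproduces \<open>c\<close>; conversely every such run is a candidate.\<close>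

lemma info_characterization:
  assumes gh: "gh \<in> partial_strategies S" and "follows gh \<psi> t" "t \<le> horizon S" "n \<in> Subs S"
    and \<omega>\<^sub>0: "\<omega>\<^sub>0 \<in> feasible S"
  shows "\<exists>F. info \<psi> gh \<omega>\<^sub>0 t n = Info F \<and> fset F =
    {(xhat_run S gh \<omega> t, map (info \<psi> gh \<omega> t) [1..<n]) | \<omega>.
       \<omega> \<in> feasible S \<and> cinfo gh \<omega> t n = cinfo gh \<omega>\<^sub>0 t n}"
proof -
  \<comment> \<open>The data and the candidate predicate \<open>R\<close> of the definition, so that it can be cited below.\<close>
  define c where "c = cinfo gh \<omega>\<^sub>0 t n"
  define z where "z = (\<lambda>l. restrict c (new_info S (Suc l) n))"
  define \<gamma> where "\<gamma> = (\<lambda>l m Ps. if l < t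
       then \<psi> l m (Ps @ map (\<lambda>i. Pi_info S fh hh \<psi> l i c) [n..<Suc (subsystems S)]) else undefined)"
  define a where "a = (\<lambda>l m. if l < t
       then \<psi> l m (map (\<lambda>i. Pi_info S fh hh \<psi> l i c) [m..<Suc (subsystems S)]) else undefined)"
  define R where "R \<omega> xh uh P \<longleftrightarrow>
       \<omega> \<in> feasible S \<and>
       xh 0 = augment S \<omega> 0 (init_state \<omega>, \<lambda>_. undefined) \<and>
       (\<forall>l<t. uh l = (\<lambda>m\<in>Subs S. if m < n then \<gamma> l m (map (P l) [m..<n]) else a l m) \<and>
              xh (Suc l) = fh l (xh l) (uh l) (disturbance \<omega> l) (noise \<omega> (Suc l)) \<and>
              z l = hh l n (xh l) (uh l)) \<and>
       (\<forall>l\<le>t. \<forall>m\<in>{1..<n}. P l m =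
          info_state S fh hh m l (\<lambda>j. hh j m (xh j) (uh j))
            (\<lambda>j i Ps. \<gamma> j i (Ps @ map (P j) [m..<n])) uh)"
    for \<omega> xh uh P
  have info_eq: "info \<psi> gh \<omega>\<^sub>0 t n = info_state S fh hh n t z \<gamma> a"
    unfolding Pi_info.simps[of S fh hh \<psi> t n] c_def z_def \<gamma>_def a_def by (rule refl)
  obtain F where F: "info \<psi> gh \<omega>\<^sub>0 t n = Info F"
      "fset F = {(xh t, map (P t) [1..<n]) | \<omega> xh uh P. R \<omega> xh uh P}"
    using info_state_members[of fh hh n t z \<gamma> a] unfolding info_eq R_def by blast
  have later: "Pi_info S fh hh \<psi> l q c = info \<psi> gh \<omega> l q"
    if "restrict c (common_info S l n) = cinfo gh \<omega> l n" "l \<le> t" "q \<in> Subs S" "n \<le> q" for \<omega> l q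
  proof -
    have "Pi_info S fh hh \<psi> l q c = Pi_info S fh hh \<psi> l q (cinfo gh \<omega> l n)"
      using Pi_info_restrict[of l n q \<psi> c] that assms(3,4) by simp
    also have "\<dots> = info \<psi> gh \<omega> l q"
      using that assms(3,4) by (intro Pi_info_past) auto
    finally show ?thesis .
  qed
  have action: "(\<lambda>m\<in>Subs S. if m < n then \<gamma> l m (map (P l) [m..<n]) else a l m) = uhat_run S gh \<omega> l"
    if "l < t" "\<And>m. m \<in> {1..<n} \<Longrightarrow> P l m = info \<psi> gh \<omega> l m"
      "\<And>q. \<lbrakk>q \<in> Subs S; n \<le> q\<rbrakk> \<Longrightarrow> Pi_info S fh hh \<psi> l q c = info \<psi> gh \<omega> l q" for P \<omega> l
  proof
    fix m
    show "(\<lambda>m\<in>Subs S. if m < n then \<gamma> l m (map (P l) [m..<n]) else a l m) m = uhat_run S gh \<omega> l m"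
    proof (cases "m \<in> Subs S")
      case True
      have "map (P l) [m..<n] @ map (\<lambda>r. Pi_info S fh hh \<psi> l r c) [n..<Suc (subsystems S)] =
          infos \<psi> gh \<omega> l m" if "m < n"
        using that True assms(4) \<open>\<And>m. m \<in> {1..<n} \<Longrightarrow> P l m = info \<psi> gh \<omega> l m\<close>
          \<open>\<And>q. \<lbrakk>q \<in> Subs S; n \<le> q\<rbrakk> \<Longrightarrow> Pi_info S fh hh \<psi> l q c = info \<psi> gh \<omega> l q\<close>
        by (intro map_upt_split) auto
      moreover have "map (\<lambda>r. Pi_info S fh hh \<psi> l r c) [m..<Suc (subsystems S)] = infos \<psi> gh \<omega> l m"
        if "\<not> m < n"
        using that True \<open>\<And>q. \<lbrakk>q \<in> Subs S; n \<le> q\<rbrakk> \<Longrightarrow> Pi_info S fh hh \<psi> l q c = info \<psi> gh \<omega> l q\<close>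
        by (intro map_cong refl) auto
      ultimately show ?thesis
        using True \<open>l < t\<close> follows_uhat_run[OF assms(2) \<open>l < t\<close> assms(3) True]
        by (simp add: \<gamma>_def a_def del: upt_Suc map_eq_conv)
    qed (auto simp: uhat_run_def)
  qed
  have attributed: "info_state S fh hh m l (\<lambda>j. hh j m (xh j) (uh j))
        (\<lambda>j i Ps. \<gamma> j i (Ps @ map (P j) [m..<n])) uh = info \<psi> gh \<omega> l m"
    if "l \<le> t" "m \<in> {1..<n}" "\<omega> \<in> feasible S"
      and hyp: "\<And>i. i < l \<Longrightarrow> xh i = xhat_run S gh \<omega> i \<and> uh i = uhat_run S gh \<omega> i \<and>
        (\<forall>q\<in>{1..<n}. P i q = info \<psi> gh \<omega> i q) \<and>
        restrict c (common_info S i n) = cinfo gh \<omega> i n" for \<omega> xh uh P l m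
    unfolding \<gamma>_def
  proof (rule attributed_info[OF assms(2,3,4) that(2,1)])
    fix i assume i: "i < l"
    show "P i q = info \<psi> gh \<omega> i q" if "q \<in> {1..<n}" for q
      using hyp[OF i] that by blast
    show "Pi_info S fh hh \<psi> i q c = info \<psi> gh \<omega> i q" if "q \<in> Subs S" "n \<le> q" for q
      using later[of i \<omega> q] hyp[OF i] i that \<open>l \<le> t\<close> by simp
    show "hh i m (xh i) (uh i) = z_run S gh \<omega> (Suc i) m"
      using model_step(2)[OF gh \<open>\<omega> \<in> feasible S\<close>, of i m] hyp[OF i] i that assms(3,4) by simp
    show "uh i = uhat_run S gh \<omega> i"
      using hyp[OF i] by blast
  qed
  have "fset F = {(xhat_run S gh \<omega> t, map (info \<psi> gh \<omega> t) [1..<n]) | \<omega>.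
       \<omega> \<in> feasible S \<and> cinfo gh \<omega> t n = c}" (is "_ = ?B")
  proof (intro equalityI subsetI)
    fix e assume "e \<in> fset F"
    then obtain \<omega> xh uh P where e: "e = (xh t, map (P t) [1..<n])" and R: "R \<omega> xh uh P"
      unfolding F(2) by blast
    have \<omega>: "\<omega> \<in> feasible S" using R by (simp add: R_def)
    have main: "xh l = xhat_run S gh \<omega> l \<and> (l < t \<longrightarrow> uh l = uhat_run S gh \<omega> l) \<and>
        (\<forall>q\<in>{1..<n}. P l q = info \<psi> gh \<omega> l q) \<and> restrict c (common_info S l n) = cinfo gh \<omega> l n"
      if "l \<le> t" for l
      using that
    proof (induction l rule: less_induct)
      case (less l)
      have IH: "xh i = xhat_run S gh \<omega> i \<and> uh i = uhat_run S gh \<omega> i \<and>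
        (\<forall>q\<in>{1..<n}. P i q = info \<psi> gh \<omega> i q) \<and>
        restrict c (common_info S i n) = cinfo gh \<omega> i n" if "i < l" for i
      proof -
        have "i \<le> t" "i < t" using that less.prems by auto
        then show ?thesis using less.IH[OF that] by blast
      qed
      have 1: "xh l = xhat_run S gh \<omega> l"
      proof (cases l)
        case 0
        then show ?thesis using R by (simp add: R_def xhat_run_def)
      next
        case (Suc i)
        then have "xh l = fh i (xh i) (uh i) (disturbance \<omega> i) (noise \<omega> (Suc i))"
          using R less.prems by (simp add: R_def)
        then show ?thesis
          using IH[of i] Suc less.prems assms(3) model_step(1)[OF gh \<omega>, of i] by simp
      qed
      have 2: "P l q = info \<psi> gh \<omega> l q" if "q \<in> {1..<n}" for q
      proof -
        have "P l q = info_state S fh hh q l (\<lambda>j. hh j q (xh j) (uh j))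
            (\<lambda>j i Ps. \<gamma> j i (Ps @ map (P j) [q..<n])) uh"
          using R that less.prems unfolding R_def by blast
        also have "\<dots> = info \<psi> gh \<omega> l q"
          by (rule attributed[OF less.prems that \<omega> IH])
        finally show ?thesis .
      qed
      have 3: "restrict c (common_info S l n) = cinfo gh \<omega> l n"
      proof -
        have "restrict c (common_info S l n) = restrict (cinfo gh \<omega> l n) (common_info S l n)"
        proof (rule restrict_common_info_eqI)
          fix i assume i: "i < l"
          have "restrict c (new_info S (Suc i) n) = hh i n (xh i) (uh i)"
            using R i less.prems by (simp add: R_def z_def)
          also have "\<dots> = z_run S gh \<omega> (Suc i) n"
            using model_step(2)[OF gh \<omega>, of i n] IH[OF i] i less.prems assms(3,4) by simp
          also have "\<dots> = restrict (cinfo gh \<omega> l n) (new_info S (Suc i) n)"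
            using cinfo_new_info[of i l n n] i less.prems assms(3,4) by simp
          finally show "restrict c (new_info S (Suc i) n) = \<dots>" .
        qed (use less.prems assms(3,4) in auto)
        then show ?thesis by (simp add: cinfo_def)
      qed
      have "uh l = uhat_run S gh \<omega> l" if "l < t"
      proof -
        have "uh l = (\<lambda>m\<in>Subs S. if m < n then \<gamma> l m (map (P l) [m..<n]) else a l m)"
          using R that unfolding R_def by blast
        also have "\<dots> = uhat_run S gh \<omega> l"
          using that 2 later[OF 3 less.prems] by (rule action)
        finally show ?thesis .
      qed
      with 1 2 3 show ?case by blast
    qed
    have "restrict c (common_info S t n) = c" by (simp add: c_def cinfo_def)
    then have "cinfo gh \<omega> t n = c" using main[of t] by simp
    moreover have "e = (xhat_run S gh \<omega> t, map (info \<psi> gh \<omega> t) [1..<n])"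
      using main[of t] unfolding e by simp
    ultimately show "e \<in> ?B" using \<omega> by blast
  next
    fix e assume "e \<in> ?B"
    then obtain \<omega> where e: "e = (xhat_run S gh \<omega> t, map (info \<psi> gh \<omega> t) [1..<n])"
      and \<omega>: "\<omega> \<in> feasible S" and c: "c = cinfo gh \<omega> t n"
      by blast
    have c': "restrict c (common_info S l n) = cinfo gh \<omega> l n" if "l \<le> t" for l
      unfolding c using that assms(3,4) by (intro cinfo_restrict) auto
    have "R \<omega> (xhat_run S gh \<omega>) (uhat_run S gh \<omega>) (info \<psi> gh \<omega>)"
      unfolding R_def
    proof (intro conjI allI impI ballI)
      show "xhat_run S gh \<omega> 0 = augment S \<omega> 0 (init_state \<omega>, \<lambda>_. undefined)"
        by (simp add: xhat_run_def)
      fix l assume l: "l < t"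
      show "uhat_run S gh \<omega> l =
          (\<lambda>m\<in>Subs S. if m < n then \<gamma> l m (map (info \<psi> gh \<omega> l) [m..<n]) else a l m)"
        using l later[OF c'] by (intro action[symmetric]) auto
      show "xhat_run S gh \<omega> (Suc l) =
          fh l (xhat_run S gh \<omega> l) (uhat_run S gh \<omega> l) (disturbance \<omega> l) (noise \<omega> (Suc l))"
        using l assms(3) by (intro model_step(1)[OF gh \<omega>]) simp
      show "z l = hh l n (xhat_run S gh \<omega> l) (uhat_run S gh \<omega> l)"
        using model_step(2)[OF gh \<omega>, of l n] cinfo_new_info[of l t n n gh \<omega>] l assms(3,4)
        by (simp add: z_def c)
    next
      fix l m assume "l \<le> t" "m \<in> {1..<n}"
      then show "info \<psi> gh \<omega> l m = info_state S fh hh m l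
          (\<lambda>j. hh j m (xhat_run S gh \<omega> j) (uhat_run S gh \<omega> j))
          (\<lambda>j i Ps. \<gamma> j i (Ps @ map (info \<psi> gh \<omega> j) [m..<n])) (uhat_run S gh \<omega>)"
        using c' \<omega> by (intro attributed[symmetric]) auto
    qed (rule \<omega>)
    then show "e \<in> fset F"
      unfolding F(2) e
      by (intro CollectI exI[of _ \<omega>] exI[of _ "xhat_run S gh \<omega>"] exI[of _ "uhat_run S gh \<omega>"]
          exI[of _ "info \<psi> gh \<omega>"] conjI refl)
  qed
  with F(1) show ?thesis unfolding c_def by blast
qed

section \<open>Representatives of information states\<close>

text \<open>The choice is total with feasible values so that strategies built from it are admissible on
  unreachable arguments as well.\<close>

definition some_feasible :: "(('x, 'w, 'v) primitives \<Rightarrow> bool) \<Rightarrow> ('x, 'w, 'v) primitives" where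
  "some_feasible Q = (if \<exists>\<omega>\<in>feasible S. Q \<omega> then SOME \<omega>. \<omega> \<in> feasible S \<and> Q \<omega>
     else SOME \<omega>. \<omega> \<in> feasible S)"

lemma some_feasible_mem: "some_feasible Q \<in> feasible S"
proof (cases "\<exists>\<omega>\<in>feasible S. Q \<omega>")
  case True
  then have "\<exists>\<omega>. \<omega> \<in> feasible S \<and> Q \<omega>" by blast
  then show ?thesis using someI_ex[of "\<lambda>\<omega>. \<omega> \<in> feasible S \<and> Q \<omega>"] True by (simp add: some_feasible_def)
next
  case False
  then show ?thesis using feasible_nonempty by (simp add: some_feasible_def some_in_eq)
qed

lemma some_feasible_sat: "\<lbrakk>\<omega> \<in> feasible S; Q \<omega>\<rbrakk> \<Longrightarrow> Q (some_feasible Q)"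
  using someI[of "\<lambda>\<omega>. \<omega> \<in> feasible S \<and> Q \<omega>" \<omega>] by (auto simp: some_feasible_def)

text \<open>The list is $[P^n, \dots, P^N]$ and its length determines \<open>n\<close>. The primitive variables stand for
  the common information that they produce at time \<open>t\<close>; the choice for \<open>n\<close> must extend the one for
  \<open>n + 1\<close>, which makes the choices of all subsystems compatible. The recursion starts with
  subsystem \<open>N\<close>, where the tail is empty and no compatibility is required.\<close>

primrec representative :: "('y, 'u) partial_strategy \<Rightarrow> ('x, 'y, 'u) structured_partial \<Rightarrow> nat
    \<Rightarrow> ('x, 'y, 'u) xinfo list \<Rightarrow> ('x, 'w, 'v) primitives" where
  "representative gh \<psi> t [] = some_feasible (\<lambda>_. True)"
| "representative gh \<psi> t (P # Ps) = some_feasible (\<lambda>\<omega>.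
     info \<psi> gh \<omega> t (subsystems S - length Ps) = P \<and>
     (Ps \<noteq> [] \<longrightarrow> cinfo gh \<omega> t (Suc (subsystems S - length Ps)) =
        cinfo gh (representative gh \<psi> t Ps) t (Suc (subsystems S - length Ps))))"

lemma representative_mem: "representative gh \<psi> t Ps \<in> feasible S"
  by (cases Ps) (simp_all add: some_feasible_mem)

text \<open>Equal information states have the same members, so whatever happens along \<open>\<omega>\<close> in the augmented
  state and the subsystems below \<open>n\<close> also happens with the common information of \<open>\<omega>'\<close>.\<close>

lemma exists_matching_primitives:
  assumes "gh \<in> partial_strategies S" "follows gh \<psi> t" "t \<le> horizon S" "n \<in> Subs S"
    and "\<omega> \<in> feasible S" "\<omega>' \<in> feasible S" "info \<psi> gh \<omega> t n = info \<psi> gh \<omega>' t n"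
  shows "\<exists>\<omega>''\<in>feasible S. cinfo gh \<omega>'' t n = cinfo gh \<omega>' t n \<and>
     xhat_run S gh \<omega>'' t = xhat_run S gh \<omega> t \<and> (\<forall>m\<in>{1..<n}. info \<psi> gh \<omega>'' t m = info \<psi> gh \<omega> t m)"
proof -
  let ?B = "\<lambda>\<omega>. {(xhat_run S gh \<omega>'' t, map (info \<psi> gh \<omega>'' t) [1..<n]) | \<omega>''.
       \<omega>'' \<in> feasible S \<and> cinfo gh \<omega>'' t n = cinfo gh \<omega> t n}"
  obtain F F' where "info \<psi> gh \<omega> t n = Info F" "fset F = ?B \<omega>"
    "info \<psi> gh \<omega>' t n = Info F'" "fset F' = ?B \<omega>'"
    using info_characterization[OF assms(1-5)] info_characterization[OF assms(1-4,6)] by blast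
  then have "?B \<omega> = ?B \<omega>'"
    using assms(7) by (metis info.inject)
  moreover have "(xhat_run S gh \<omega> t, map (info \<psi> gh \<omega> t) [1..<n]) \<in> ?B \<omega>"
    using assms(5) by blast
  ultimately have "(xhat_run S gh \<omega> t, map (info \<psi> gh \<omega> t) [1..<n]) \<in> ?B \<omega>'" by (simp only:)
  then show ?thesis by auto
qed

text \<open>The choices succeed on lists of information states that occur along a run: \<open>\<omega>\<close> itself is a
  witness for subsystem \<open>N\<close>, and \<open>exists_matching_primitives\<close> at \<open>n + 1\<close> provides one for \<open>n\<close>.\<close>

lemma representative_spec:
  assumes "gh \<in> partial_strategies S" "follows gh \<psi> t" "t \<le> horizon S" "n \<in> Subs S"
    and "\<omega> \<in> feasible S"
  shows "info \<psi> gh (representative gh \<psi> t (infos \<psi> gh \<omega> t n)) t n = info \<psi> gh \<omega> t n \<and>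
    (n < subsystems S \<longrightarrow> cinfo gh (representative gh \<psi> t (infos \<psi> gh \<omega> t n)) t (Suc n) =
       cinfo gh (representative gh \<psi> t (infos \<psi> gh \<omega> t (Suc n))) t (Suc n))"
proof -
  define r where "r n = representative gh \<psi> t (infos \<psi> gh \<omega> t n)" for n
  define Q where "Q n \<omega>' \<longleftrightarrow> info \<psi> gh \<omega>' t n = info \<psi> gh \<omega> t n \<and>
     (n < subsystems S \<longrightarrow> cinfo gh \<omega>' t (Suc n) = cinfo gh (r (Suc n)) t (Suc n))" for n \<omega>'
  have r: "r n = some_feasible (Q n)" if "n \<le> subsystems S" for n
  proof -
    have "infos \<psi> gh \<omega> t n = info \<psi> gh \<omega> t n # infos \<psi> gh \<omega> t (Suc n)"
      using that by (subst upt_conv_Cons) auto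
    moreover have "length (infos \<psi> gh \<omega> t (Suc n)) = subsystems S - n"
      by (simp del: upt_Suc)
    moreover have "infos \<psi> gh \<omega> t (Suc n) \<noteq> [] \<longleftrightarrow> n < subsystems S"
      by auto
    ultimately show ?thesis
      using that unfolding r_def Q_def by (simp del: upt_Suc)
  qed
  have "n \<le> subsystems S" using assms(4) by simp
  then have "Q n (r n)"
  proof (induction n rule: inc_induct)
    case base
    show ?case
      unfolding r[OF order_refl] by (rule some_feasible_sat[OF assms(5)]) (simp add: Q_def)
  next
    case (step m)
    have "Suc m \<in> Subs S" using step.hyps by simp
    moreover have "r (Suc m) \<in> feasible S" by (simp add: r_def representative_mem)
    moreover have "info \<psi> gh \<omega> t (Suc m) = info \<psi> gh (r (Suc m)) t (Suc m)"
      using step.IH by (simp add: Q_def)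
    ultimately obtain \<omega>'' where "\<omega>'' \<in> feasible S" "cinfo gh \<omega>'' t (Suc m) = cinfo gh (r (Suc m)) t (Suc m)"
      "\<forall>i\<in>{1..<Suc m}. info \<psi> gh \<omega>'' t i = info \<psi> gh \<omega> t i"
      using exists_matching_primitives[OF assms(1-3) _ assms(5)] by blast
    then have "Q m \<omega>''"
      using step.hyps assms(4) by (simp add: Q_def)
    then have "Q m (some_feasible (Q m))"
      using some_feasible_sat[OF \<open>\<omega>'' \<in> feasible S\<close>] by blast
    then show ?case using r[of m] step.hyps by simp
  qed
  then show ?thesis by (simp add: Q_def r_def)
qed

text \<open>The representatives of all subsystems come from nested choices, so a single trajectory that
  matches the one of subsystem \<open>1\<close>, the best informed, matches them all; \<open>exists_matching_primitives\<close>
  at \<open>n = 1\<close> lets it have the actual augmented state.\<close>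

lemma representatives_realized:
  assumes "gh \<in> partial_strategies S" "follows gh \<psi> t" "t \<le> horizon S" "\<omega> \<in> feasible S"
  shows "\<exists>\<omega>'\<in>feasible S. xhat_run S gh \<omega>' t = xhat_run S gh \<omega> t \<and>
    (\<forall>n\<in>Subs S. cinfo gh \<omega>' t n = cinfo gh (representative gh \<psi> t (infos \<psi> gh \<omega> t n)) t n)"
proof -
  define r where "r n = representative gh \<psi> t (infos \<psi> gh \<omega> t n)" for n
  have spec: "info \<psi> gh (r n) t n = info \<psi> gh \<omega> t n"
      "n < subsystems S \<Longrightarrow> cinfo gh (r n) t (Suc n) = cinfo gh (r (Suc n)) t (Suc n)"
    if "n \<in> Subs S" for n
    using representative_spec[OF assms(1-3) that assms(4)] unfolding r_def by blast+
  have "1 \<in> Subs S" using subsystems_pos by simp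
  moreover have "r 1 \<in> feasible S" by (simp add: r_def representative_mem)
  ultimately obtain \<omega>' where \<omega>': "\<omega>' \<in> feasible S" "cinfo gh \<omega>' t 1 = cinfo gh (r 1) t 1"
    "xhat_run S gh \<omega>' t = xhat_run S gh \<omega> t"
    using exists_matching_primitives[OF assms(1-3) _ assms(4)] spec(1)[of 1] by force
  have "cinfo gh \<omega>' t n = cinfo gh (r n) t n" if "1 \<le> n" "n \<le> subsystems S" for n
    using that
  proof (induction n rule: dec_induct)
    case base
    show ?case by (rule \<omega>'(2))
  next
    case (step n)
    have sub: "n \<in> Subs S" "Suc n \<in> Subs S" using step.hyps step.prems by auto
    have "cinfo gh \<omega>' t (Suc n) = restrict (cinfo gh \<omega>' t n) (common_info S t (Suc n))"
      using cinfo_restrict[of t t n "Suc n"] sub assms(3) by simp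
    also have "\<dots> = restrict (cinfo gh (r n) t n) (common_info S t (Suc n))"
      using step by simp
    also have "\<dots> = cinfo gh (r n) t (Suc n)"
      using cinfo_restrict[of t t n "Suc n"] sub assms(3) by simp
    also have "\<dots> = cinfo gh (r (Suc n)) t (Suc n)"
      using spec(2)[OF sub(1)] sub(2) by simp
    finally show ?case .
  qed
  with \<omega>' show ?thesis unfolding r_def by auto
qed

section \<open>Making a strategy structured at one more time\<close>

text \<open>In the common information \<open>c\<close> of subsystem \<open>n\<close> at time \<open>s \<ge> t\<close>, the part known at time \<open>t\<close> is
  replaced by its representative. Computing the information states at time \<open>t\<close> from \<open>c\<close> is legitimate
  since they depend only on that part.\<close>

definition substitute_past :: "('y, 'u) partial_strategy \<Rightarrow> ('x, 'y, 'u) structured_partial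
    \<Rightarrow> nat \<Rightarrow> nat \<Rightarrow> nat \<Rightarrow> ('y, 'u) realization \<Rightarrow> ('y, 'u) realization" where
  "substitute_past gh \<psi> t s n c = (\<lambda>a\<in>common_info S s n. if a \<in> common_info S t n
     then cinfo gh (representative gh \<psi> t (Pi_infos S fh hh \<psi> t n c)) t n a else c a)"

definition switch :: "('y, 'u) partial_strategy \<Rightarrow> ('x, 'y, 'u) structured_partial \<Rightarrow> nat
    \<Rightarrow> ('y, 'u) partial_strategy" where
  "switch gh \<psi> t s n c = (if s < t then gh s n c else gh s n (substitute_past gh \<psi> t s n c))"

definition switch_law :: "('y, 'u) partial_strategy \<Rightarrow> ('x, 'y, 'u) structured_partial \<Rightarrow> nat
    \<Rightarrow> ('x, 'y, 'u) structured_partial" where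
  "switch_law gh \<psi> t = \<psi>(t := \<lambda>n Ps. gh t n (cinfo gh (representative gh \<psi> t Ps) t n))"

lemma partial_strategiesD:
  "\<lbrakk>gh \<in> partial_strategies S; t \<le> horizon S; n \<in> Subs S; c \<in> realizations S (common_info S t n)\<rbrakk>
    \<Longrightarrow> gh t n c \<in> partial_actions S t n"
  by (auto simp: partial_strategies_def)

lemma cinfo_realization:
  assumes "gh \<in> partial_strategies S" "\<omega> \<in> feasible S" "t \<le> horizon S" "n \<in> Subs S"
  shows "cinfo gh \<omega> t n \<in> realizations S (common_info S t n)"
  unfolding cinfo_def
  using restrict_run_realization[OF induced_control_mem[OF assms(1)] assms(2,3)]
    common_info_past[OF assms(3,4)] by blast

lemma switch_mem:
  assumes "gh \<in> partial_strategies S" "t \<le> horizon S"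
  shows "switch gh \<psi> t \<in> partial_strategies S"
proof -
  have "switch gh \<psi> t s n c \<in> partial_actions S s n"
    if *: "s \<le> horizon S" "n \<in> Subs S" "c \<in> realizations S (common_info S s n)" for s n c
  proof -
    have "cinfo gh (representative gh \<psi> t (Pi_infos S fh hh \<psi> t n c)) t n \<in> realizations S (common_info S t n)"
      using assms * by (intro cinfo_realization representative_mem) auto
    then have "substitute_past gh \<psi> t s n c \<in> realizations S (common_info S s n)"
      using *(3) unfolding substitute_past_def realizations_def
      by (auto simp: PiE_iff)
    then show ?thesis
      unfolding switch_def using * assms by (simp add: partial_strategiesD)
  qed
  then show ?thesis by (simp add: partial_strategies_def)
qed

lemma switch_law_mem:
  assumes "gh \<in> partial_strategies S" "\<psi> \<in> structured_partials S"
  shows "switch_law gh \<psi> t \<in> structured_partials S"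
  using assms(2) partial_strategiesD[OF assms(1) _ _ cinfo_realization[OF assms(1) representative_mem]]
  by (auto simp: structured_partials_def switch_law_def)

lemma Pi_info_switch_law:
  assumes "s \<le> t" "n \<in> Subs S"
  shows "Pi_info S fh hh (switch_law gh \<psi> t) s n c = Pi_info S fh hh \<psi> s n c"
  using assms by (intro Pi_info_cong) (auto simp: switch_law_def)

lemma Pi_infos_switch_law:
  assumes "s \<le> t" "n \<in> Subs S"
  shows "Pi_infos S fh hh (switch_law gh \<psi> t) s n c = Pi_infos S fh hh \<psi> s n c"
  unfolding Pi_infos_def using assms by (intro map_cong refl Pi_info_switch_law) auto

lemma switch_follows:
  assumes "follows gh \<psi> t"
  shows "follows (switch gh \<psi> t) (switch_law gh \<psi> t) (Suc t)"
  unfolding follows_def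
proof (intro allI impI ballI)
  fix s n c assume s: "s < Suc t" and n: "n \<in> Subs S"
  show "switch gh \<psi> t s n c = partial_strategy_of S fh hh (switch_law gh \<psi> t) s n c"
  proof (cases "s = t")
    case True
    have "substitute_past gh \<psi> t t n c = cinfo gh (representative gh \<psi> t (Pi_infos S fh hh \<psi> t n c)) t n"
      by (auto simp: substitute_past_def cinfo_def restrict_def)
    then show ?thesis
      using True n
      by (simp add: switch_def partial_strategy_of_def Pi_infos_switch_law) (simp add: switch_law_def)
  next
    case False
    then show ?thesis
      using assms s n
      by (simp add: switch_def partial_strategy_of_def Pi_infos_switch_law follows_def) (simp add: switch_law_def)
  qed
qed

text \<open>The noise at time \<open>t\<close> comes from the first argument since the augmented state at time \<open>t\<close>
  contains the observations of that time, while the disturbance at time \<open>t\<close> acts only afterwards.\<close>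

definition splice :: "nat \<Rightarrow> ('x, 'w, 'v) primitives \<Rightarrow> ('x, 'w, 'v) primitives \<Rightarrow> ('x, 'w, 'v) primitives"
  where
  "splice t \<omega> \<omega>' = \<lparr>init_state = init_state \<omega>,
     disturbance = (\<lambda>s. if s < t then disturbance \<omega> s else disturbance \<omega>' s),
     noise = (\<lambda>s. if s \<le> t then noise \<omega> s else noise \<omega>' s)\<rparr>"

lemma splice_mem: "\<lbrakk>\<omega> \<in> feasible S; \<omega>' \<in> feasible S\<rbrakk> \<Longrightarrow> splice t \<omega> \<omega>' \<in> feasible S"
  by (auto simp: feasible_def splice_def PiE_iff extensional_def)

lemma run_splice: "s \<le> t \<Longrightarrow> run S g (splice t \<omega> \<omega>') s = run S g \<omega> s"
  by (induction s) (simp_all add: splice_def)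

lemma xhat_run_splice: "xhat_run S gh (splice t \<omega> \<omega>') t = xhat_run S gh \<omega> t"
  unfolding xhat_run_def run_splice[OF order_refl] by (simp add: augment_def splice_def)

lemma run_switch:
  "s \<le> t \<Longrightarrow> run S (induced_control S (switch gh \<psi> t)) \<omega> s = run S (induced_control S gh) \<omega> s"
  by (induction s) (simp_all add: induced_control_def switch_def)

text \<open>Playing as if the representatives had occurred is what \<open>gh\<close> does on a spliced trajectory. The
  two runs have the same augmented state at time \<open>t\<close>, and from then on the same partial actions,
  hence the same augmented states and new information by the model equations.\<close>

lemma switch_trajectory:
  assumes gh: "gh \<in> partial_strategies S" and "follows gh \<psi> t" and t: "t \<le> horizon S"
    and \<omega>: "\<omega> \<in> feasible S"
  shows "\<exists>\<omega>'\<in>feasible S. \<forall>s. t \<le> s \<longrightarrow> s \<le> horizon S \<longrightarrow>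
    xhat_run S (switch gh \<psi> t) \<omega> s = xhat_run S gh \<omega>' s"
proof -
  let ?gh = "switch gh \<psi> t"
  have gh': "?gh \<in> partial_strategies S" by (rule switch_mem[OF gh t])
  obtain \<omega>\<^sub>0 where \<omega>\<^sub>0: "\<omega>\<^sub>0 \<in> feasible S" "xhat_run S gh \<omega>\<^sub>0 t = xhat_run S gh \<omega> t"
    and rep: "\<forall>n\<in>Subs S.
      cinfo gh \<omega>\<^sub>0 t n = cinfo gh (representative gh \<psi> t (infos \<psi> gh \<omega> t n)) t n"
    using representatives_realized[OF gh assms(2) t \<omega>] by (elim bexE conjE)
  define \<omega>' where "\<omega>' = splice t \<omega>\<^sub>0 \<omega>"
  have \<omega>': "\<omega>' \<in> feasible S" unfolding \<omega>'_def by (rule splice_mem[OF \<omega>\<^sub>0(1) \<omega>])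
  have cinfo_t: "cinfo ?gh \<omega> t n = cinfo gh \<omega> t n" "cinfo gh \<omega>' t n = cinfo gh \<omega>\<^sub>0 t n" for n
    by (simp_all add: cinfo_def run_switch \<omega>'_def run_splice)
  have "xhat_run S ?gh \<omega> s = xhat_run S gh \<omega>' s \<and>
      (\<forall>n\<in>Subs S. \<forall>a\<in>common_info S s n - common_info S t n. hist ?gh \<omega> s a = hist gh \<omega>' s a)"
    if "t \<le> s" "s \<le> horizon S" for s
    using that
  proof (induction s rule: dec_induct)
    case base
    have "xhat_run S ?gh \<omega> t = xhat_run S gh \<omega> t"
      by (simp add: xhat_run_def run_switch)
    then show ?case using \<omega>\<^sub>0(2) by (simp add: \<omega>'_def xhat_run_splice)
  next
    case (step s)
    have s: "s \<le> horizon S" "s < horizon S" using step.prems by auto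
    have IH: "xhat_run S ?gh \<omega> s = xhat_run S gh \<omega>' s"
      "\<And>n a. \<lbrakk>n \<in> Subs S; a \<in> common_info S s n; a \<notin> common_info S t n\<rbrakk>
        \<Longrightarrow> hist ?gh \<omega> s a = hist gh \<omega>' s a"
      using step.IH s by auto
    \<comment> \<open>What the new strategy pretends to know is what is known on the spliced trajectory.\<close>
    have past: "substitute_past gh \<psi> t s n (cinfo ?gh \<omega> s n) = cinfo gh \<omega>' s n" if n: "n \<in> Subs S" for n
    proof -
      have "Pi_infos S fh hh \<psi> t n (cinfo ?gh \<omega> s n) = infos \<psi> ?gh \<omega> t n"
        unfolding Pi_infos_def using step.hyps s n by (intro Pi_infos_past) auto
      then have "cinfo gh (representative gh \<psi> t (Pi_infos S fh hh \<psi> t n (cinfo ?gh \<omega> s n))) t n =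
          cinfo gh \<omega>' t n"
        using rep n by (simp add: cinfo_t del: upt_Suc map_eq_conv)
      moreover have "cinfo gh \<omega>' t n a = hist gh \<omega>' s a" if "a \<in> common_info S t n" for a
        using that common_info_past[OF t n] history_stable[OF \<open>t \<le> s\<close>, of a]
        by (auto simp: cinfo_def)
      ultimately show ?thesis
        using IH(2)[OF n] unfolding substitute_past_def
        by (intro ext) (simp add: cinfo_def restrict_def)
    qed
    have uhat: "uhat_run S ?gh \<omega> s = uhat_run S gh \<omega>' s"
      unfolding uhat_run_cinfo using past step.hyps by (intro restrict_ext) (simp add: switch_def)
    have "xhat_run S ?gh \<omega> (Suc s) = xhat_run S gh \<omega>' (Suc s)"
      unfolding model_step(1)[OF gh' \<omega> s(2)] model_step(1)[OF gh \<omega>' s(2)] IH(1) uhat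
      using step.hyps by (simp add: \<omega>'_def splice_def)
    moreover have "hist ?gh \<omega> (Suc s) a = hist gh \<omega>' (Suc s) a"
      if n: "n \<in> Subs S" and a: "a \<in> common_info S (Suc s) n" "a \<notin> common_info S t n" for n a
    proof (cases "a \<in> common_info S s n")
      case True
      then have "a \<in> past_labels s" using common_info_past[OF s(1) n] by blast
      then show ?thesis
        using history_stable[of s "Suc s" a] IH(2)[OF n True a(2)] by (simp del: run.simps)
    next
      case False
      then have "a \<in> new_info S (Suc s) n" using a(1) common_info_Suc[OF s(2) n] by blast
      moreover have "z_run S ?gh \<omega> (Suc s) n = z_run S gh \<omega>' (Suc s) n"
        unfolding model_step(2)[OF gh' \<omega> s(2) n] model_step(2)[OF gh \<omega>' s(2) n] IH(1) uhat
        by (rule refl)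
      ultimately show ?thesis
        unfolding z_run_def by (metis restrict_apply')
    qed
    ultimately show ?case by blast
  qed
  with \<omega>' show ?thesis by blast
qed

lemma Jhat_switch_le:
  assumes "gh \<in> partial_strategies S" "follows gh \<psi> t" "t \<le> horizon S"
  shows "Jhat S (switch gh \<psi> t) \<le> Jhat S gh"
  unfolding Jhat_def
proof (rule Max_mono)
  show "(\<lambda>\<omega>. terminal_cost_hat S (xhat_run S (switch gh \<psi> t) \<omega> (horizon S))) ` feasible S \<subseteq>
      (\<lambda>\<omega>. terminal_cost_hat S (xhat_run S gh \<omega> (horizon S))) ` feasible S"
  proof
    fix d assume "d \<in> (\<lambda>\<omega>. terminal_cost_hat S (xhat_run S (switch gh \<psi> t) \<omega> (horizon S))) ` feasible S"
    then obtain \<omega> where "\<omega> \<in> feasible S" "d = terminal_cost_hat S (xhat_run S (switch gh \<psi> t) \<omega> (horizon S))"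
      by blast
    then show "d \<in> (\<lambda>\<omega>. terminal_cost_hat S (xhat_run S gh \<omega> (horizon S))) ` feasible S"
      using switch_trajectory[OF assms, of \<omega>] assms(3) by auto
  qed
qed (use feasible_nonempty finite_feasible in auto)

lemma partial_strategy_of_mem:
  "\<psi> \<in> structured_partials S \<Longrightarrow> partial_strategy_of S fh hh \<psi> \<in> partial_strategies S"
  by (simp add: structured_partials_def partial_strategies_def partial_strategy_of_def)

text \<open>Switching at the times \<open>0, 1, \<dots>\<close> before the horizon suffices, because the action at the
  horizon has no effect on the terminal state.\<close>

lemma structured_partial_improves:
  assumes "gh \<in> partial_strategies S"
  shows "\<exists>\<psi>\<in>structured_partials S. Jhat S (partial_strategy_of S fh hh \<psi>) \<le> Jhat S gh"
proof -
  have "\<exists>gh'\<in>partial_strategies S. \<exists>\<psi>\<in>structured_partials S. follows gh' \<psi> t \<and> Jhat S gh' \<le> Jhat S gh"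
    if "t \<le> horizon S" for t
    using that
  proof (induction t)
    case 0
    obtain \<omega> where "\<omega> \<in> feasible S" using feasible_nonempty by blast
    then have "(\<lambda>t n Ps. gh t n (cinfo gh \<omega> t n)) \<in> structured_partials S"
      using partial_strategiesD[OF assms _ _ cinfo_realization[OF assms]]
      by (simp add: structured_partials_def)
    then show ?case using assms by (auto simp: follows_def)
  next
    case (Suc t)
    then obtain gh' \<psi> where *: "gh' \<in> partial_strategies S" "\<psi> \<in> structured_partials S"
      "follows gh' \<psi> t" "Jhat S gh' \<le> Jhat S gh" by auto
    have "switch gh' \<psi> t \<in> partial_strategies S" using * Suc.prems by (intro switch_mem) auto
    moreover have "switch_law gh' \<psi> t \<in> structured_partials S" using * by (intro switch_law_mem)
    moreover have "follows (switch gh' \<psi> t) (switch_law gh' \<psi> t) (Suc t)" using * by (intro switch_follows)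
    moreover have "Jhat S (switch gh' \<psi> t) \<le> Jhat S gh"
      using Jhat_switch_le[OF *(1,3)] *(4) Suc.prems by simp
    ultimately show ?case by blast
  qed
  from this[OF order_refl] obtain gh' \<psi> where *: "gh' \<in> partial_strategies S"
      "\<psi> \<in> structured_partials S" "follows gh' \<psi> (horizon S)" "Jhat S gh' \<le> Jhat S gh"
    by blast
  have "Jhat S gh' = Jhat S (partial_strategy_of S fh hh \<psi>)"
    unfolding Jhat_J using *(3) by (intro J_cong induced_control_mem *(1)) (simp add: induced_control_def follows_def)
  with * show ?thesis by auto
qed

section \<open>Control strategies and partial strategies\<close>

text \<open>An agent's memory is the disjoint union of common and private information, so a control law
  becomes a partial one by currying.\<close>

definition partial_of_arbitrary_control :: "('y, 'u) control \<Rightarrow> ('y, 'u) partial_strategy" where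
  "partial_of_arbitrary_control g t n c = (\<lambda>k\<in>Ags S n.
     \<lambda>(y, l)\<in>observations S t n k \<times> realizations S (private_info S t n k).
       g t n k y (\<lambda>a\<in>memory S t n k. if a \<in> common_info S t n then c a else l a))"

lemma partial_of_arbitrary_control_mem:
  assumes "g \<in> controls S"
  shows "partial_of_arbitrary_control g \<in> partial_strategies S"
proof -
  have "(\<lambda>a\<in>memory S t n k. if a \<in> common_info S t n then c a else l a) \<in> realizations S (memory S t n k)"
    if "c \<in> realizations S (common_info S t n)" "l \<in> realizations S (private_info S t n k)" for t n k c l
    using that by (intro restrict_realization) (auto simp: realizations_def private_info_def)
  then have "partial_of_arbitrary_control g t n c \<in> partial_actions S t n"
    if "t \<le> horizon S" "n \<in> Subs S" "c \<in> realizations S (common_info S t n)" for t n c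
    unfolding partial_of_arbitrary_control_def partial_actions_def restrict_PiE_iff
    using that by (auto intro!: controls_mem[OF assms])
  then show ?thesis by (simp add: partial_strategies_def)
qed

lemma induced_control_partial_of_arbitrary_control:
  assumes "k \<in> Ags S n" "y \<in> observations S t n k" "m \<in> realizations S (memory S t n k)"
  shows "induced_control S (partial_of_arbitrary_control g) t n k y m = g t n k y m"
proof -
  have "restrict m (private_info S t n k) \<in> realizations S (private_info S t n k)"
    using assms(3) by (intro restrict_realization) (auto simp: realizations_def private_info_def)
  moreover have "(\<lambda>a\<in>memory S t n k. if a \<in> common_info S t n
      then restrict m (common_info S t n) a else restrict m (private_info S t n k) a) = m"
    using assms(3) by (intro ext) (auto simp: realizations_def private_info_def PiE_iff extensional_def)
  ultimately show ?thesis
    using assms by (simp add: induced_control_def partial_of_arbitrary_control_def)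
qed

lemma Jhat_partial_of_arbitrary_control:
  assumes "g \<in> controls S"
  shows "Jhat S (partial_of_arbitrary_control g) = J S g"
  unfolding Jhat_J
  by (rule J_cong[symmetric, OF assms]) (simp add: induced_control_partial_of_arbitrary_control)

lemma controls_nonempty: "controls S \<noteq> {}"
proof -
  have "(\<lambda>t n k y m. SOME u. u \<in> actions S t n k) \<in> controls S"
    using actions_finite by (simp add: controls_def some_in_eq)
  then show ?thesis by blast
qed

lemma exists_optimal_structured_partial:
  "\<exists>\<psi>\<in>structured_partials S. \<forall>gh\<in>partial_strategies S.
     Jhat S (partial_strategy_of S fh hh \<psi>) \<le> Jhat S gh"
proof -
  have "Jhat S ` partial_strategies S \<subseteq> terminal_cost S ` states S (horizon S)"
    using J_attained[OF induced_control_mem] by (auto simp: Jhat_J)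
  then have "finite (Jhat S ` partial_strategies S)"
    using states_finite finite_subset by blast
  moreover have "Jhat S ` partial_strategies S \<noteq> {}"
    using controls_nonempty partial_of_arbitrary_control_mem by blast
  ultimately have "Min (Jhat S ` partial_strategies S) \<in> Jhat S ` partial_strategies S"
    and least: "\<And>gh'. gh' \<in> partial_strategies S \<Longrightarrow> Min (Jhat S ` partial_strategies S) \<le> Jhat S gh'"
    by (simp_all add: Min_in)
  then obtain gh where "gh \<in> partial_strategies S" "Jhat S gh = Min (Jhat S ` partial_strategies S)"
    by (metis (no_types, lifting) imageE)
  then show ?thesis
    using structured_partial_improves[of gh] least by (metis order_trans)
qed

definition control_of_partial :: "('x, 'y, 'u) structured_partial \<Rightarrow> ('x, 'y, 'u) structured_control" where
  "control_of_partial \<psi> t n k y l Ps = \<psi> t n Ps k (y, l)"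

lemma control_of_partial_mem:
  "\<psi> \<in> structured_partials S \<Longrightarrow> control_of_partial \<psi> \<in> structured_controls S"
  by (fastforce simp: structured_partials_def structured_controls_def control_of_partial_def
      partial_actions_def PiE_iff)

text \<open>Equality holds up to the horizon and for existing subsystems only: elsewhere a structured law
  need not have extensional values. By \<open>Pi_info_cong\<close> this is enough for the information states to
  agree.\<close>

lemma partial_of_control_of_partial:
  assumes "\<psi> \<in> structured_partials S" "t \<le> horizon S" "n \<in> Subs S"
  shows "partial_of_control S (control_of_partial \<psi>) t n = \<psi> t n"
proof
  fix Ps
  have "\<psi> t n Ps \<in> partial_actions S t n" using assms by (simp add: structured_partials_def)
  then have \<psi>: "\<psi> t n Ps \<in> extensional (Ags S n)"
      "\<psi> t n Ps k \<in> extensional (observations S t n k \<times> realizations S (private_info S t n k))"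
      if "k \<in> Ags S n" for k
    using that by (auto simp: partial_actions_def PiE_iff)
  have "partial_of_control S (control_of_partial \<psi>) t n Ps = restrict (\<psi> t n Ps) (Ags S n)"
    unfolding partial_of_control_def control_of_partial_def case_prod_eta
    using extensional_restrict[OF \<psi>(2)] by (intro restrict_ext) simp
  also have "\<dots> = \<psi> t n Ps"
    using \<psi>(1)[of 1] agents_pos[OF assms(3)] by (intro extensional_restrict) simp
  finally show "partial_of_control S (control_of_partial \<psi>) t n Ps = \<psi> t n Ps" .
qed

lemma control_of_partial_induced:
  assumes "\<psi> \<in> structured_partials S" "t \<le> horizon S" "n \<in> Subs S"
  shows "control_of S fh hh (control_of_partial \<psi>) t n k y m =
    induced_control S (partial_strategy_of S fh hh \<psi>) t n k y m"
proof -
  have "Pi_infos S fh hh (partial_of_control S (control_of_partial \<psi>)) t n c = Pi_infos S fh hh \<psi> t n c" for c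
    unfolding Pi_infos_def using assms partial_of_control_of_partial[OF assms(1)]
    by (intro map_cong refl Pi_info_cong) auto
  then show ?thesis
    by (simp add: control_of_def induced_control_def partial_strategy_of_def control_of_partial_def)
qed

end

section \<open>Optimality of structured strategies\<close>

theorem theorem4:
  fixes S :: "('x, 'u, 'y, 'w, 'v) system"
    and fh :: "('x, 'u, 'y, 'w, 'v) fhat"
    and hh :: "('x, 'u, 'y) hhat"
  assumes "nested_system S"
    and "model_functions S fh hh"
  shows "(\<exists>\<psi>\<in>structured_partials S.
            is_arg_min (Jhat S) (\<lambda>gh. gh \<in> partial_strategies S) (partial_strategy_of S fh hh \<psi>)) \<and>
         (\<exists>\<phi>\<in>structured_controls S.
            is_arg_min (J S) (\<lambda>g. g \<in> controls S) (control_of S fh hh \<phi>))"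
proof -
  interpret modelled_system S fh hh
    using assms by (intro modelled_system.intro modelled_system_axioms.intro)
  obtain \<psi> where \<psi>: "\<psi> \<in> structured_partials S"
    and opt: "\<And>gh. gh \<in> partial_strategies S \<Longrightarrow> Jhat S (partial_strategy_of S fh hh \<psi>) \<le> Jhat S gh"
    using exists_optimal_structured_partial by blast
  let ?gh = "partial_strategy_of S fh hh \<psi>"
  let ?g = "control_of S fh hh (control_of_partial \<psi>)"
  have gh: "?gh \<in> partial_strategies S" by (rule partial_strategy_of_mem[OF \<psi>])
  have ind: "induced_control S ?gh \<in> controls S" by (rule induced_control_mem[OF gh])
  have g: "?g \<in> controls S"
    using ind control_of_partial_induced[OF \<psi>] by (simp add: controls_def)
  have Jg: "J S ?g = Jhat S ?gh"
    unfolding Jhat_J by (rule J_cong[OF g]) (simp add: control_of_partial_induced[OF \<psi>])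
  have "J S ?g \<le> J S g'" if "g' \<in> controls S" for g'
    using opt[OF partial_of_arbitrary_control_mem[OF that]] Jg
    by (simp add: Jhat_partial_of_arbitrary_control[OF that])
  then have "is_arg_min (J S) (\<lambda>g. g \<in> controls S) ?g"
    using g by (auto simp: is_arg_min_linorder)
  moreover have "is_arg_min (Jhat S) (\<lambda>gh. gh \<in> partial_strategies S) ?gh"
    using gh opt by (auto simp: is_arg_min_linorder)
  ultimately show ?thesis
    using \<psi> control_of_partial_mem[OF \<psi>] by blast
qed

end
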